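(* Let $L$ be a first order constant coefficient linear differential operator on $\mathbb{T}^1\times\mathbb{R}$, $$L=c_1\partial_t+c_2\partial_x+c_3,$$ for some $c_1,c_2,c_3\in\mathbb{C}$ with $c_1\neq0$ or $c_2\neq0$. Then $L$ is Schwartz globally hypoelliptic if and only if $$Z:=\{(k,\xi)\in\mathbb{Z}\times\mathbb{R}\;|\;c_1k+c_2\xi-ic_3=0\}=\emptyset.$$
   Context: $\mathbb{T}^1=\mathbb{R}/2\pi\mathbb{Z}$, with variables $(t,x)\in\mathbb{T}^1\times\mathbb{R}$. $\mathcal{S}(\mathbb{T}^1\times\mathbb{R})$ is the Fréchet space of all complex-valued $f\in C^\infty(\mathbb{T}^1\times\mathbb{R})$ such that $\|f\|_{\alpha,\beta,\gamma}:=\sup_{(t,x)}|x^\gamma\partial_t^\alpha\partial_x^\beta f(t,x)|<+\infty$ for all nonnegative integers $\alpha,\beta,\gamma$, with seminorms $p_N(f):=\sum_{\alpha+\beta+\gamma\leq N}\|f\|_{\alpha,\beta,\gamma}$. $\mathcal{S}'(\mathbb{T}^1\times\mathbb{R})$ is its topological dual; functions of at most polynomial growth in $x$, uniformly in $t$, are identified with elements of $\mathcal{S}'(\mathbb{T}^1\times\mathbb{R})$ through $f\mapsto\int uf\,dt\,dx$, and differential operators act on $\mathcal{S}'$ in the usual distributional (dual) sense. A differential operator $L:\mathcal{S}'(\mathbb{T}^1\times\mathbb{R})\to\mathcal{S}'(\mathbb{T}^1\times\mathbb{R})$ is called Schwartz globally hypoelliptic (SGH) if whenever $u\in\mathcal{S}'(\mathbb{T}^1\times\mathbb{R})$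 and $Lu\in\mathcal{S}(\mathbb{T}^1\times\mathbb{R})$, then $u\in\mathcal{S}(\mathbb{T}^1\times\mathbb{R})$. *)

theory Defs
  imports "HOL-Analysis.Analysis"
begin

text \<open>A function on the cylinder \<open>(\<real>/2\<pi>\<int>) \<times> \<real>\<close> is represented by a function of
  \<open>(t, x) \<in> \<real> \<times> \<real>\<close> that is \<open>2\<pi>\<close>-periodic in \<open>t\<close>; periodicity is imposed in \<open>schwartz\<close>.\<close>

type_synonym cyl_fun = "real \<times> real \<Rightarrow> complex"

definition dt :: "cyl_fun \<Rightarrow> cyl_fun" where
  "dt f = (\<lambda>(t, x). vector_derivative (\<lambda>s. f (s, x)) (at t))"

definition dx :: "cyl_fun \<Rightarrow> cyl_fun" where
  "dx f = (\<lambda>(t, x). vector_derivative (\<lambda>y. f (t, y)) (at x))"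

primrec C_diff :: "nat \<Rightarrow> cyl_fun \<Rightarrow> bool" where
  "C_diff 0 f \<longleftrightarrow> continuous_on UNIV f"
| "C_diff (Suc k) f \<longleftrightarrow> f differentiable_on UNIV \<and> C_diff k (dt f) \<and> C_diff k (dx f)"

definition smooth :: "cyl_fun \<Rightarrow> bool" where
  "smooth f \<longleftrightarrow> (\<forall>k. C_diff k f)"

definition weighted_deriv :: "nat \<Rightarrow> nat \<Rightarrow> nat \<Rightarrow> cyl_fun \<Rightarrow> real \<times> real \<Rightarrow> real" where
  "weighted_deriv \<alpha> \<beta> \<gamma> f = (\<lambda>(t, x). norm (of_real (x ^ \<gamma>) * (dt ^^ \<alpha>) ((dx ^^ \<beta>) f) (t, x)))"

definition schwartz :: "cyl_fun set" where
  "schwartz = {f. smooth f \<and> (\<forall>t x. f (t + 2 * pi, x) = f (t, x)) \<and>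
     (\<forall>\<alpha> \<beta> \<gamma>. bdd_above (range (weighted_deriv \<alpha> \<beta> \<gamma> f)))}"

text \<open>The supremum is a real one, hence meaningful only for functions in \<open>schwartz\<close>.\<close>

definition schwartz_norm :: "nat \<Rightarrow> nat \<Rightarrow> nat \<Rightarrow> cyl_fun \<Rightarrow> real" where
  "schwartz_norm \<alpha> \<beta> \<gamma> f = (SUP p. weighted_deriv \<alpha> \<beta> \<gamma> f p)"

definition schwartz_seminorm :: "nat \<Rightarrow> cyl_fun \<Rightarrow> real" where
  "schwartz_seminorm N f =
     (\<Sum>(\<alpha>, \<beta>, \<gamma>) \<in> {(\<alpha>, \<beta>, \<gamma>). \<alpha> + \<beta> + \<gamma> \<le> N}. schwartz_norm \<alpha> \<beta> \<gamma> f)"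

definition schwartz_topology :: "cyl_fun topology" where
  "schwartz_topology = topology_generated_by
     {{g \<in> schwartz. schwartz_seminorm N (\<lambda>p. g p - f p) < \<epsilon>} | f N \<epsilon>. f \<in> schwartz \<and> \<epsilon> > 0}"

text \<open>A distribution is a functional on \<open>schwartz\<close>. Since functions in HOL are total, a functional
  also has (irrelevant) values outside \<open>schwartz\<close>; two functionals are the same distribution
  iff they agree on \<open>schwartz\<close>.\<close>

type_synonym cyl_functional = "cyl_fun \<Rightarrow> complex"

definition tempered :: "cyl_functional set" where
  "tempered = {u.
     (\<forall>f\<in>schwartz. \<forall>g\<in>schwartz. u (\<lambda>p. f p + g p) = u f + u g) \<and>
     (\<forall>a. \<forall>f\<in>schwartz. u (\<lambda>p. a * f p) = a * u f) \<and>
     continuous_map schwartz_topology euclidean u}"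

text \<open>The half-open strip is a fundamental domain of the cylinder.\<close>

definition functional_of :: "cyl_fun \<Rightarrow> cyl_functional" where
  "functional_of f =
     (\<lambda>\<phi>. set_lebesgue_integral lborel ({0..<2 * pi} \<times> UNIV) (\<lambda>p. f p * \<phi> p))"

definition is_schwartz :: "cyl_functional \<Rightarrow> bool" where
  "is_schwartz u \<longleftrightarrow> (\<exists>f\<in>schwartz. \<forall>\<phi>\<in>schwartz. u \<phi> = functional_of f \<phi>)"

definition dist_dt :: "cyl_functional \<Rightarrow> cyl_functional" where
  "dist_dt u = (\<lambda>\<phi>. - u (dt \<phi>))"

definition dist_dx :: "cyl_functional \<Rightarrow> cyl_functional" where
  "dist_dx u = (\<lambda>\<phi>. - u (dx \<phi>))"

definition first_order_op :: "complex \<Rightarrow> complex \<Rightarrow> complex \<Rightarrow> cyl_functional \<Rightarrow> cyl_functional" where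
  "first_order_op c1 c2 c3 u = (\<lambda>\<phi>. c1 * dist_dt u \<phi> + c2 * dist_dx u \<phi> + c3 * u \<phi>)"

definition schwartz_globally_hypoelliptic :: "(cyl_functional \<Rightarrow> cyl_functional) \<Rightarrow> bool" where
  "schwartz_globally_hypoelliptic L \<longleftrightarrow> (\<forall>u\<in>tempered. is_schwartz (L u) \<longrightarrow> is_schwartz u)"

end

theory Submission
  imports Defs "HOL-Probability.Sinc_Integral" "HOL-Computational_Algebra.Polynomial"
begin

text \<open>
  The operator \<open>L = c1 \<partial>\<^sub>t + c2 \<partial>\<^sub>x + c3\<close> multiplies the plane wave \<open>exp (i (k t + \<xi> x))\<close> by
  \<open>i (c1 k + c2 \<xi> - i c3)\<close>, so \<open>Z\<close> lists the plane waves that \<open>L\<close> annihilates.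

  If \<open>Z\<close> is not empty, such a plane wave is a tempered distribution \<open>u\<close> with \<open>L u = 0\<close>. It is not
  a Schwartz function: paired with Gaussian wave packets of modulus at most one and width \<open>R\<close>, it
  gives values that grow like \<open>R\<close>, while the pairings with an integrable function stay bounded
  (\<open>plane_wave_not_schwartz\<close>).

  If \<open>Z\<close> is empty, the point is that \<open>L\<close> maps the Schwartz space onto itself (\<open>schwartz_solvable\<close>).
  The transpose \<open>- c1 \<partial>\<^sub>t - c2 \<partial>\<^sub>x + c3\<close> has the zero set \<open>- Z\<close>, hence it is onto as well. Now let
  \<open>L u = f\<close> with \<open>f\<close> Schwartz and pick a Schwartz function \<open>v\<close> with \<open>L v = f\<close>. Every test function
  \<open>\<phi>\<close> is the transpose applied to some Schwartz function \<open>\<psi>\<close>, and therefore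
  \<open>u(\<phi>) = (L u)(\<psi>) = \<integral> f \<psi> = \<integral> (L v) \<psi> = \<integral> v \<phi>\<close>, that is, \<open>u = v\<close>.

  To solve \<open>L v = f\<close>, expand in Fourier series in \<open>t\<close>. The \<open>k\<close>-th coefficient \<open>w\<close> of \<open>v\<close> has to
  satisfy \<open>c2 w' + \<lambda> w = h\<close> on the line, where \<open>\<lambda> = i k c1 + c3\<close> and \<open>h\<close> is the coefficient of \<open>f\<close>.
  For \<open>c2 \<noteq> 0\<close> the emptiness of \<open>Z\<close> says that \<open>Re (\<lambda> / c2)\<close> vanishes for no \<open>k\<close>; as this number is
  affine in the integer \<open>k\<close>, it stays at a positive distance from zero, and for \<open>c2 = 0\<close> the same
  holds for \<open>\<lambda>\<close> itself (\<open>symbol_bounded_away\<close>). So each equation has a bounded solution that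
  inherits the decay of \<open>h\<close> with constants independent of \<open>k\<close> (\<open>resolvent_ladder\<close>). Since the
  coefficients of \<open>f\<close> decrease rapidly in \<open>k\<close>, the resulting Fourier series converges with all its
  derivatives to a Schwartz function, and it solves the equation because \<open>f\<close> is the sum of its own
  Fourier series (\<open>fourier_series_sums\<close>).
\<close>

section \<open>Jets of Schwartz functions\<close>

text \<open>\<open>F a b\<close> stands for \<open>\<partial>\<^sub>t\<^sup>a \<partial>\<^sub>x\<^sup>b\<close> of \<open>F 0 0\<close>. Carrying all mixed derivatives along lets
  Schwartz functions be built termwise from series and products, where every derivative is known
  explicitly. The weights \<open>(1 + x\<^sup>2) ^ n\<close> replace the powers of \<open>x\<close> because they are positive and
  at least one.\<close>

definition schwartz_jet :: "(nat \<Rightarrow> nat \<Rightarrow> cyl_fun) \<Rightarrow> bool" where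
  "schwartz_jet F \<longleftrightarrow>
     (\<forall>a b t x. ((\<lambda>s. F a b (s, x)) has_vector_derivative F (Suc a) b (t, x)) (at t)) \<and>
     (\<forall>a b t x. ((\<lambda>y. F a b (t, y)) has_vector_derivative F a (Suc b) (t, x)) (at x)) \<and>
     (\<forall>a b t x. F a b (t + 2 * pi, x) = F a b (t, x)) \<and>
     (\<forall>a b n. \<exists>M. \<forall>t x. (1 + x\<^sup>2) ^ n * norm (F a b (t, x)) \<le> M)"

lemma schwartz_jetD:
  assumes "schwartz_jet F"
  shows "((\<lambda>s. F a b (s, x)) has_vector_derivative F (Suc a) b (t, x)) (at t)"
    and "((\<lambda>y. F a b (t, y)) has_vector_derivative F a (Suc b) (t, x)) (at x)"
    and "F a b (t + 2 * pi, x) = F a b (t, x)"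
    and "\<exists>M. \<forall>t x. (1 + x\<^sup>2) ^ n * norm (F a b (t, x)) \<le> M"
  using assms unfolding schwartz_jet_def by blast+

lemma dist_le_of_vector_derivative_bound:
  fixes f :: "real \<Rightarrow> 'a::real_normed_vector"
  assumes "\<And>s. (f has_vector_derivative f' s) (at s)" "\<And>s. norm (f' s) \<le> B"
  shows "norm (f s - f t) \<le> B * \<bar>s - t\<bar>"
proof -
  have "norm (f s - f t) \<le> B * norm (s - t)"
  proof (rule differentiable_bound[of UNIV f "\<lambda>x h. h *\<^sub>R f' x"])
    show "onorm (\<lambda>h. h *\<^sub>R f' x) \<le> B" for x
      using assms(2)[of x] order_trans[OF norm_ge_zero assms(2)]
      by (intro onorm_bound) (auto simp: mult.commute[of B] intro!: mult_left_mono)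
  qed (use assms(1) in \<open>auto simp: has_vector_derivative_def\<close>)
  then show ?thesis by simp
qed

text \<open>Bounded partial derivatives make each entry of a jet Lipschitz, so continuity of the
  entries need not be part of the definition.\<close>

lemma schwartz_jet_continuous:
  assumes F: "schwartz_jet F"
  shows "continuous_on UNIV (F a b)"
proof -
  obtain B1 where B1: "\<And>t x. norm (F (Suc a) b (t, x)) \<le> B1"
    using schwartz_jetD(4)[OF F, of 0 "Suc a" b] by auto
  obtain B2 where B2: "\<And>t x. norm (F a (Suc b) (t, x)) \<le> B2"
    using schwartz_jetD(4)[OF F, of 0 a "Suc b"] by auto
  have B0: "0 \<le> B1" "0 \<le> B2"
    using order_trans[OF norm_ge_zero B1] order_trans[OF norm_ge_zero B2] by auto
  have lip: "norm (F a b p - F a b q) \<le> (B1 + B2) * dist p q" for p q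
  proof -
    obtain s x t y where [simp]: "p = (s, x)" "q = (t, y)" by (cases p, cases q)
    have "norm (F a b (s, x) - F a b (t, x)) \<le> B1 * \<bar>s - t\<bar>"
      by (rule dist_le_of_vector_derivative_bound[OF schwartz_jetD(1)[OF F] B1])
    moreover have "norm (F a b (t, x) - F a b (t, y)) \<le> B2 * \<bar>x - y\<bar>"
      by (rule dist_le_of_vector_derivative_bound[OF schwartz_jetD(2)[OF F] B2])
    ultimately have "norm (F a b p - F a b q) \<le> B1 * \<bar>s - t\<bar> + B2 * \<bar>x - y\<bar>"
      using norm_triangle_le[of "F a b (s, x) - F a b (t, x)" "F a b (t, x) - F a b (t, y)"]
      by simp
    also have "\<dots> \<le> B1 * dist p q + B2 * dist p q"
      using dist_fst_le[of p q] dist_snd_le[of p q] B0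
      by (intro add_mono mult_left_mono) (auto simp: dist_real_def)
    finally show ?thesis by (simp add: algebra_simps)
  qed
  show ?thesis
  proof (rule lipschitz_on_continuous_on)
    show "(B1 + B2)-lipschitz_on UNIV (F a b)"
      using lip B0 by (intro lipschitz_onI) (auto simp: dist_norm)
  qed
qed

lemma schwartz_jet_dt: "schwartz_jet F \<Longrightarrow> dt (F a b) = F (Suc a) b"
  using vector_derivative_at[OF schwartz_jetD(1)[of F]] by (auto simp: dt_def fun_eq_iff)

lemma schwartz_jet_dx: "schwartz_jet F \<Longrightarrow> dx (F a b) = F a (Suc b)"
  using vector_derivative_at[OF schwartz_jetD(2)[of F]] by (auto simp: dx_def fun_eq_iff)

text \<open>Partial derivatives that are continuous in both variables yield the total derivative
  that smoothness asks for.\<close>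

lemma schwartz_jet_differentiable:
  assumes F: "schwartz_jet F"
  shows "F a b differentiable (at p)"
proof -
  obtain t x where p: "p = (t, x)" by (cases p)
  have c: "continuous (at (t, x)) (F a (Suc b))"
    using schwartz_jet_continuous[OF F, of a "Suc b"] by (simp add: continuous_on_eq_continuous_at)
  have "((\<lambda>(t, x). curry (F a b) t x) has_derivative
      (\<lambda>(h, k). h *\<^sub>R F (Suc a) b (t, x) + blinfun_scaleR_left (F a (Suc b) (t, x)) k))
      (at (t, x) within UNIV \<times> UNIV)"
  proof (rule has_derivative_partialsI[where fy = "\<lambda>t x. blinfun_scaleR_left (F a (Suc b) (t, x))"])
    show "((\<lambda>s. curry (F a b) s x) has_derivative (\<lambda>h. h *\<^sub>R F (Suc a) b (t, x))) (at t within UNIV)"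
      using schwartz_jetD(1)[OF F] by (simp add: has_vector_derivative_def)
    show "((\<lambda>y. curry (F a b) t' y) has_derivative blinfun_scaleR_left (F a (Suc b) (t', x')))
        (at x' within UNIV)" for t' x'
      using schwartz_jetD(2)[OF F] by (simp add: has_vector_derivative_def)
    show "continuous (at (t, x) within UNIV \<times> UNIV)
        (\<lambda>(t, x). blinfun_scaleR_left (F a (Suc b) (t, x)))"
      using bounded_linear.isCont[OF bounded_linear_blinfun_scaleR_left c]
      by (simp add: split_def)
  qed auto
  then show ?thesis unfolding p differentiable_def by auto
qed

lemma schwartz_jet_smooth:
  assumes F: "schwartz_jet F"
  shows "smooth (F a b)"
proof -
  have "C_diff k (F a b)" for k
    by (induction k arbitrary: a b)
      (auto simp: schwartz_jet_dt[OF F] schwartz_jet_dx[OF F] differentiable_on_def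
        schwartz_jet_continuous[OF F] schwartz_jet_differentiable[OF F])
  then show ?thesis by (simp add: smooth_def)
qed

lemma schwartz_jet_iterate:
  assumes F: "schwartz_jet F"
  shows "(dt ^^ i) ((dx ^^ j) (F a b)) = F (a + i) (b + j)"
proof -
  have "(dx ^^ j) (F a b) = F a (b + j)"
    by (induction j) (auto simp: schwartz_jet_dx[OF F])
  moreover have "(dt ^^ i) (F a c) = F (a + i) c" for c
    by (induction i) (auto simp: schwartz_jet_dt[OF F])
  ultimately show ?thesis by simp
qed

lemma abs_power_le_weight: "\<bar>x::real\<bar> ^ n \<le> (1 + x\<^sup>2) ^ n"
proof (rule power_mono)
  have "0 \<le> (\<bar>x\<bar> - 1)\<^sup>2" "0 \<le> x\<^sup>2" by simp_all
  then show "\<bar>x\<bar> \<le> 1 + x\<^sup>2" unfolding power2_diff by simp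
qed simp

lemma weight_le_sum_powers: "(1 + (x::real)\<^sup>2) ^ n \<le> 2 ^ n * (1 + \<bar>x\<bar> ^ (2 * n))"
proof (cases "\<bar>x\<bar> \<le> 1")
  case True
  then have "x\<^sup>2 \<le> 1" by (simp only: abs_square_le_1)
  then have "(1 + x\<^sup>2) ^ n \<le> 2 ^ n" by (intro power_mono) auto
  also have "\<dots> \<le> 2 ^ n * (1 + \<bar>x\<bar> ^ (2 * n))" by simp
  finally show ?thesis .
next
  case False
  then have "1 \<le> \<bar>x\<bar>\<^sup>2" using one_le_power[of "\<bar>x\<bar>" 2] by simp
  then have "(1 + x\<^sup>2) ^ n \<le> (2 * \<bar>x\<bar>\<^sup>2) ^ n" by (intro power_mono) auto
  also have "\<dots> = 2 ^ n * \<bar>x\<bar> ^ (2 * n)" by (simp add: power_mult_distrib power_even_abs flip: power_mult)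
  also have "\<dots> \<le> 2 ^ n * (1 + \<bar>x\<bar> ^ (2 * n))" by simp
  finally show ?thesis .
qed

lemma schwartz_jet_in_schwartz:
  assumes F: "schwartz_jet F"
  shows "F a b \<in> schwartz"
proof -
  have "bdd_above (range (weighted_deriv \<alpha> \<beta> \<gamma> (F a b)))" for \<alpha> \<beta> \<gamma>
  proof -
    obtain M where M: "\<And>t x. (1 + x\<^sup>2) ^ \<gamma> * norm (F (a + \<alpha>) (b + \<beta>) (t, x)) \<le> M"
      using schwartz_jetD(4)[OF F] by blast
    have "weighted_deriv \<alpha> \<beta> \<gamma> (F a b) p \<le> M" for p
    proof -
      obtain t x where p: "p = (t, x)" by (cases p)
      have "\<bar>x\<bar> ^ \<gamma> * norm (F (a + \<alpha>) (b + \<beta>) (t, x)) \<le> M"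
        using M[of x t] mult_right_mono[OF abs_power_le_weight, of "norm (F (a + \<alpha>) (b + \<beta>) (t, x))" x \<gamma>]
        by simp
      then show ?thesis
        by (simp add: p weighted_deriv_def schwartz_jet_iterate[OF F] norm_mult norm_power)
    qed
    then show ?thesis by (auto simp: bdd_above_def)
  qed
  then show ?thesis
    using schwartz_jet_smooth[OF F] schwartz_jetD(3)[OF F] by (auto simp: schwartz_def)
qed

section \<open>Derivatives of Schwartz functions\<close>

lemma smooth_dt: "smooth f \<Longrightarrow> smooth (dt f)" and smooth_dx: "smooth f \<Longrightarrow> smooth (dx f)"
  by (metis C_diff.simps(2) smooth_def)+

lemma smooth_iterate: "smooth f \<Longrightarrow> smooth ((dt ^^ a) ((dx ^^ b) f))"
proof -
  assume "smooth f"
  then have "smooth ((dx ^^ b) f)" by (induction b) (auto intro: smooth_dx)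
  then show ?thesis by (induction a) (auto intro: smooth_dt)
qed

lemma smooth_continuous: "smooth f \<Longrightarrow> continuous_on UNIV f"
  by (metis C_diff.simps(1) smooth_def)

lemma smooth_differentiable: "smooth f \<Longrightarrow> f differentiable (at p)"
  by (metis C_diff.simps(2) smooth_def differentiable_on_def UNIV_I)

lemma smooth_has_dt:
  assumes "smooth f"
  shows "((\<lambda>s. f (s, x)) has_vector_derivative dt f (t, x)) (at t)"
proof -
  have "(\<lambda>s. f (s, x)) differentiable (at t)"
    using differentiable_chain_at[of "\<lambda>s. (s, x)" t f] smooth_differentiable[OF assms]
    by (simp add: o_def differentiable_Pair)
  then show ?thesis by (simp add: dt_def vector_derivative_works)
qed

lemma smooth_has_dx:
  assumes "smooth f"
  shows "((\<lambda>y. f (t, y)) has_vector_derivative dx f (t, x)) (at x)"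
proof -
  have "(\<lambda>y. f (t, y)) differentiable (at x)"
    using differentiable_chain_at[of "\<lambda>y. (t, y)" x f] smooth_differentiable[OF assms]
    by (simp add: o_def differentiable_Pair)
  then show ?thesis by (simp add: dx_def vector_derivative_works)
qed

lemma schwartz_smooth: "f \<in> schwartz \<Longrightarrow> smooth f"
  and schwartz_periodic: "f \<in> schwartz \<Longrightarrow> f (t + 2 * pi, x) = f (t, x)"
  by (auto simp: schwartz_def)

lemma periodic_iterate:
  assumes "\<And>t x. f (t + 2 * pi, x) = f (t, x)"
  shows "(dt ^^ a) ((dx ^^ b) f) (t + 2 * pi, x) = (dt ^^ a) ((dx ^^ b) f) (t, x)"
proof -
  define P :: "cyl_fun \<Rightarrow> bool" where "P g \<longleftrightarrow> (\<forall>t x. g (t + 2 * pi, x) = g (t, x))" for g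
  have dx: "P (dx g)" if "P g" for g
    using that by (auto simp: P_def dx_def)
  have dt: "P (dt g)" if "P g" for g
    unfolding P_def dt_def prod.case
  proof (intro allI)
    fix t x
    have "vector_derivative (\<lambda>s. g (s, x)) (at (t + 2 * pi)) =
        vector_derivative (\<lambda>s. g (s + 2 * pi, x)) (at t)"
      unfolding vector_derivative_def has_vector_derivative_def has_derivative_at
      by (simp add: algebra_simps)
    then show "vector_derivative (\<lambda>s. g (s, x)) (at (t + 2 * pi)) =
        vector_derivative (\<lambda>s. g (s, x)) (at t)"
      using that by (simp add: P_def)
  qed
  have "P ((dx ^^ b) f)" by (induction b) (use assms dx in \<open>auto simp: P_def\<close>)
  then have "P ((dt ^^ a) ((dx ^^ b) f))" by (induction a) (use dt in auto)
  then show ?thesis by (simp add: P_def)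
qed

lemma schwartz_weighted_bound:
  assumes "f \<in> schwartz"
  shows "\<exists>M. \<forall>t x. (1 + x\<^sup>2) ^ n * norm ((dt ^^ a) ((dx ^^ b) f) (t, x)) \<le> M"
proof -
  have bdd: "\<exists>M. \<forall>t x. \<bar>x\<bar> ^ \<gamma> * norm ((dt ^^ a) ((dx ^^ b) f) (t, x)) \<le> M" for \<gamma>
  proof -
    have "bdd_above (range (weighted_deriv a b \<gamma> f))"
      using assms by (auto simp: schwartz_def)
    then obtain M where "\<And>p. weighted_deriv a b \<gamma> f p \<le> M"
      by (auto simp: bdd_above_def)
    then show ?thesis
      by (intro exI[of _ M]) (auto simp: weighted_deriv_def norm_mult norm_power dest!: meta_spec[of _ "(_, _)"])
  qed
  obtain M0 where M0: "\<And>t x. norm ((dt ^^ a) ((dx ^^ b) f) (t, x)) \<le> M0"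
    using bdd[of 0] by auto
  obtain M1 where M1: "\<And>t x. \<bar>x\<bar> ^ (2 * n) * norm ((dt ^^ a) ((dx ^^ b) f) (t, x)) \<le> M1"
    using bdd by blast
  show ?thesis
  proof (intro exI allI)
    fix t x
    let ?N = "norm ((dt ^^ a) ((dx ^^ b) f) (t, x))"
    have "(1 + x\<^sup>2) ^ n * ?N \<le> 2 ^ n * (1 + \<bar>x\<bar> ^ (2 * n)) * ?N"
      by (intro mult_right_mono weight_le_sum_powers) auto
    also have "\<dots> = 2 ^ n * (?N + \<bar>x\<bar> ^ (2 * n) * ?N)" by (simp add: algebra_simps)
    also have "\<dots> \<le> 2 ^ n * (M0 + M1)"
      using M0[of t x] M1[of x t] by (intro mult_left_mono add_mono) auto
    finally show "(1 + x\<^sup>2) ^ n * ?N \<le> 2 ^ n * (M0 + M1)" .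
  qed
qed

section \<open>Integration over the cylinder\<close>

abbreviation strip :: "(real \<times> real) set" where
  "strip \<equiv> {0..<2 * pi} \<times> UNIV"

abbreviation strip_integral :: "(real \<times> real \<Rightarrow> complex) \<Rightarrow> complex" where
  "strip_integral F \<equiv> set_lebesgue_integral lborel strip F"

definition bounded_continuous :: "cyl_fun \<Rightarrow> bool" where
  "bounded_continuous F \<longleftrightarrow> continuous_on UNIV F \<and> (\<exists>M. \<forall>p. norm (F p) \<le> M)"

text \<open>The weight \<open>1 + x\<^sup>2\<close> is enough for integrability over the strip and for the boundary terms
  at \<open>x = \<plusminus>\<infinity>\<close> to vanish.\<close>

definition decaying :: "cyl_fun \<Rightarrow> bool" where
  "decaying F \<longleftrightarrow> continuous_on UNIV F \<and> (\<exists>M. \<forall>t x. (1 + x\<^sup>2) * norm (F (t, x)) \<le> M)"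

lemma decaying_add:
  assumes "decaying F" "decaying G"
  shows "decaying (\<lambda>p. F p + G p)"
proof -
  obtain M N where "\<And>t x. (1 + x\<^sup>2) * norm (F (t, x)) \<le> M" "\<And>t x. (1 + x\<^sup>2) * norm (G (t, x)) \<le> N"
    using assms by (auto simp: decaying_def)
  then have "(1 + x\<^sup>2) * norm (F (t, x) + G (t, x)) \<le> M + N" for t x
    by (intro order_trans[OF mult_left_mono[OF norm_triangle_ineq]])
      (auto simp: distrib_left intro: add_mono)
  then show ?thesis using assms by (auto simp: decaying_def intro!: continuous_on_add)
qed

lemma decaying_mult:
  assumes "bounded_continuous F" "decaying G"
  shows "decaying (\<lambda>p. F p * G p)"
proof -
  obtain M N where M: "\<And>p. norm (F p) \<le> M" and N: "\<And>t x. (1 + x\<^sup>2) * norm (G (t, x)) \<le> N"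
    using assms by (auto simp: decaying_def bounded_continuous_def)
  have "0 \<le> M" using order_trans[OF norm_ge_zero M] .
  have "(1 + x\<^sup>2) * norm (F (t, x) * G (t, x)) \<le> M * N" for t x
  proof -
    have "(1 + x\<^sup>2) * norm (F (t, x) * G (t, x)) = norm (F (t, x)) * ((1 + x\<^sup>2) * norm (G (t, x)))"
      by (simp add: norm_mult)
    also have "\<dots> \<le> M * N" using M N \<open>0 \<le> M\<close> by (intro mult_mono) auto
    finally show ?thesis .
  qed
  then show ?thesis
    using assms by (auto simp: decaying_def bounded_continuous_def intro!: continuous_on_mult)
qed

lemma decaying_imp_bounded:
  assumes "decaying F"
  shows "bounded_continuous F"
proof -
  obtain M where M: "\<And>t x. (1 + x\<^sup>2) * norm (F (t, x)) \<le> M"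
    using assms by (auto simp: decaying_def)
  have "norm (F p) \<le> M" for p
  proof -
    obtain t x where p: "p = (t, x)" by (cases p)
    have "1 * norm (F (t, x)) \<le> (1 + x\<^sup>2) * norm (F (t, x))" by (intro mult_right_mono) auto
    then show ?thesis using M[of x t] by (simp add: p)
  qed
  then show ?thesis using assms by (auto simp: decaying_def bounded_continuous_def)
qed

lemma decaying_le:
  assumes "decaying F"
  obtains M where "0 \<le> M" "\<And>t x. norm (F (t, x)) \<le> M * inverse (1 + x\<^sup>2)"
proof -
  obtain M where M: "\<And>t x. (1 + x\<^sup>2) * norm (F (t, x)) \<le> M"
    using assms by (auto simp: decaying_def)
  have "norm (F (t, x)) \<le> M * inverse (1 + x\<^sup>2)" for t x
  proof -
    have "0 < 1 + x\<^sup>2" by (simp add: add_pos_nonneg)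
    then show ?thesis using M[of x t] by (simp add: field_simps)
  qed
  moreover have "0 \<le> M" using order_trans[OF _ M[of 0 0]] by simp
  ultimately show ?thesis using that by blast
qed

lemma integrable_inverse_1_plus_square_UNIV: "integrable lborel (\<lambda>x::real. inverse (1 + x\<^sup>2))"
  using integrable_inverse_1_plus_square by (simp add: set_integrable_def)

lemma strip_measurable [measurable]: "strip \<in> sets borel"
  by (simp add: borel_Times)

lemma continuous_on_slice_fst: "continuous_on UNIV F \<Longrightarrow> continuous_on A (\<lambda>t. F (t, x))"
  and continuous_on_slice_snd: "continuous_on UNIV F \<Longrightarrow> continuous_on A (\<lambda>x. F (t, x))"
  for F :: cyl_fun
  by (rule continuous_on_compose2[of UNIV F A], (auto intro!: continuous_intros)[3])+

lemma integrable_strip_weight: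
  "set_integrable lborel strip (\<lambda>p. inverse (1 + (snd p)\<^sup>2))"
proof -
  have "integrable (lborel \<Otimes>\<^sub>M lborel) (\<lambda>p. indicator strip p *\<^sub>R inverse (1 + (snd p)\<^sup>2))"
  proof (rule lborel_pair.Fubini_integrable)
    show "(\<lambda>p. indicator strip p *\<^sub>R inverse (1 + (snd p)\<^sup>2)) \<in> borel_measurable (lborel \<Otimes>\<^sub>M lborel)"
      unfolding lborel_prod
      by (intro borel_measurable_scaleR borel_measurable_indicator)
        (auto intro!: borel_measurable_continuous_onI continuous_intros simp: add_nonneg_eq_0_iff)
    show "integrable lborel (\<lambda>t. \<integral>x. norm (indicator strip (t, x) *\<^sub>R inverse (1 + (snd (t, x))\<^sup>2)) \<partial>lborel)"
      by (simp add: indicator_times abs_mult)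
    show "AE t in lborel. integrable lborel (\<lambda>x. indicator strip (t, x) *\<^sub>R inverse (1 + (snd (t, x))\<^sup>2))"
      using integrable_inverse_1_plus_square_UNIV by (simp add: indicator_times)
  qed
  then show ?thesis by (simp add: lborel_prod set_integrable_def)
qed

lemma continuous_borel_measurable: "continuous_on UNIV F \<Longrightarrow> F \<in> borel_measurable borel"
  for F :: cyl_fun
  by (rule borel_measurable_continuous_onI)

lemma decaying_integrable:
  assumes "decaying F"
  shows "set_integrable lborel strip F"
proof -
  obtain M where M: "0 \<le> M" "\<And>t x. norm (F (t, x)) \<le> M * inverse (1 + x\<^sup>2)"
    using decaying_le[OF assms] by blast
  have [measurable]: "F \<in> borel_measurable borel"
    using assms by (auto simp: decaying_def intro: continuous_borel_measurable)
  show ?thesis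
  proof (rule set_integrable_bound)
    show "set_integrable lborel strip (\<lambda>p. M * inverse (1 + (snd p)\<^sup>2))"
      by (intro set_integrable_mult_right integrable_strip_weight)
    show "set_borel_measurable lborel strip F"
      unfolding set_borel_measurable_def by measurable
    show "AE p in lborel. p \<in> strip \<longrightarrow> norm (F p) \<le> norm (M * inverse (1 + (snd p)\<^sup>2))"
    proof (intro AE_I2 impI)
      fix p
      show "norm (F p) \<le> norm (M * inverse (1 + (snd p)\<^sup>2))"
        using M by (cases p) (simp add: abs_mult add_nonneg_nonneg)
    qed
  qed
qed

lemma
  assumes "decaying F"
  shows strip_integral_iterated:
      "strip_integral F = (\<integral>t. indicator {0..<2 * pi} t *\<^sub>R (\<integral>x. F (t, x) \<partial>lborel) \<partial>lborel)"
    and strip_integral_iterated_swap: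
      "strip_integral F = (\<integral>x. (LINT t:{0..<2 * pi}|lborel. F (t, x)) \<partial>lborel)"
proof -
  have int: "integrable (lborel \<Otimes>\<^sub>M lborel) (\<lambda>(t, x). indicator strip (t, x) *\<^sub>R F (t, x))"
    using decaying_integrable[OF assms] by (simp add: set_integrable_def lborel_prod split_def)
  have eq: "strip_integral F = (\<integral>(t, x). indicator strip (t, x) *\<^sub>R F (t, x) \<partial>(lborel \<Otimes>\<^sub>M lborel))"
    by (simp add: set_lebesgue_integral_def lborel_prod split_def)
  show "strip_integral F = (\<integral>t. indicator {0..<2 * pi} t *\<^sub>R (\<integral>x. F (t, x) \<partial>lborel) \<partial>lborel)"
    unfolding eq lborel_pair.integral_fst[OF int, symmetric] by (simp add: indicator_times)
  show "strip_integral F = (\<integral>x. (LINT t:{0..<2 * pi}|lborel. F (t, x)) \<partial>lborel)"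
    unfolding eq lborel_pair.integral_snd[OF int, symmetric]
    by (simp add: indicator_times set_lebesgue_integral_def)
qed

text \<open>Integrating in \<open>t\<close> first leaves the increment of \<open>H\<close> over one period.\<close>

lemma strip_integral_dt_eq_0:
  assumes H': "\<And>t x. ((\<lambda>s. H (s, x)) has_vector_derivative H' (t, x)) (at t)"
    and per: "\<And>t x. H (t + 2 * pi, x) = H (t, x)" and dec: "decaying H'"
  shows "strip_integral H' = 0"
proof -
  have "(LINT t:{0..<2 * pi}|lborel. H' (t, x)) = 0" for x
  proof -
    have cont: "continuous_on A (\<lambda>t. H' (t, x))" for A
      using dec by (intro continuous_on_slice_fst) (auto simp: decaying_def)
    have "(LBINT t=ereal 0..ereal (2 * pi). H' (t, x)) = H (2 * pi, x) - H (0, x)"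
      by (rule interval_integral_FTC_finite[OF cont has_vector_derivative_at_within[OF H']])
    then show ?thesis using per[of 0 x] interval_integral_Ico[of 0 "2 * pi" "\<lambda>t. H' (t, x)"]
      by (simp add: zero_ereal_def)
  qed
  then show ?thesis by (simp add: strip_integral_iterated_swap[OF dec])
qed

text \<open>Integrating in \<open>x\<close> first leaves the difference of the limits of \<open>H\<close> at \<open>\<plusminus>\<infinity>\<close>.\<close>

lemma strip_integral_dx_eq_0:
  assumes H': "\<And>t x. ((\<lambda>y. H (t, y)) has_vector_derivative H' (t, x)) (at x)"
    and decH: "decaying H" and dec: "decaying H'"
  shows "strip_integral H' = 0"
proof -
  have "(\<integral>x. H' (t, x) \<partial>lborel) = 0" for t
  proof -
    have cont: "continuous_on A (\<lambda>x. H' (t, x))" for A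
      using dec by (intro continuous_on_slice_snd) (auto simp: decaying_def)
    obtain M where M: "\<And>t x. norm (H' (t, x)) \<le> M * inverse (1 + x\<^sup>2)" using decaying_le[OF dec] by metis
    obtain N where N: "\<And>t x. norm (H (t, x)) \<le> N * inverse (1 + x\<^sup>2)" using decaying_le[OF decH] by metis
    have int: "integrable lborel (\<lambda>x. H' (t, x))"
    proof (rule Bochner_Integration.integrable_bound)
      show "integrable lborel (\<lambda>x. M * inverse (1 + x\<^sup>2))"
        by (intro integrable_mult_right integrable_inverse_1_plus_square_UNIV)
      show "(\<lambda>x. H' (t, x)) \<in> borel_measurable lborel"
        using borel_measurable_continuous_onI[OF cont] by simp
      show "AE x in lborel. norm (H' (t, x)) \<le> norm (M * inverse (1 + x\<^sup>2))"
        using M order_trans[OF M abs_ge_self] by (intro AE_I2) simp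
    qed
    have top: "((\<lambda>x. H (t, x)) \<longlongrightarrow> 0) at_top"
    proof (rule Lim_null_comparison)
      show "\<forall>\<^sub>F x in at_top. norm (H (t, x)) \<le> N * inverse (1 + x\<^sup>2)" using N by simp
      show "((\<lambda>x::real. N * inverse (1 + x\<^sup>2)) \<longlongrightarrow> 0) at_top" by real_asymp
    qed
    have bot: "((\<lambda>x. H (t, x)) \<longlongrightarrow> 0) at_bot"
    proof (rule Lim_null_comparison)
      show "\<forall>\<^sub>F x in at_bot. norm (H (t, x)) \<le> N * inverse (1 + x\<^sup>2)" using N by simp
      show "((\<lambda>x::real. N * inverse (1 + x\<^sup>2)) \<longlongrightarrow> 0) at_bot" by real_asymp
    qed
    have "(LBINT x=-\<infinity>..\<infinity>. H' (t, x)) = 0 - 0"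
      using cont[of UNIV] int top bot
      by (intro interval_integral_FTC_integrable[where F = "\<lambda>x. H (t, x)"] H')
        (auto simp: ereal_tendsto_simps1 continuous_on_eq_continuous_at set_integrable_def)
    then show ?thesis
      by (simp add: interval_lebesgue_integral_def set_lebesgue_integral_def)
  qed
  then show ?thesis by (simp add: strip_integral_iterated[OF dec])
qed

lemma strip_integral_add:
  "decaying F \<Longrightarrow> decaying G \<Longrightarrow> strip_integral (\<lambda>p. F p + G p) = strip_integral F + strip_integral G"
  by (intro set_integral_add decaying_integrable)

lemma strip_integration_by_parts_dt:
  assumes f: "\<And>t x. ((\<lambda>s. f (s, x)) has_vector_derivative f' (t, x)) (at t)"
    and g: "\<And>t x. ((\<lambda>s. g (s, x)) has_vector_derivative g' (t, x)) (at t)"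
    and per: "\<And>t x. f (t + 2 * pi, x) = f (t, x)" "\<And>t x. g (t + 2 * pi, x) = g (t, x)"
    and bdd: "bounded_continuous f" "bounded_continuous f'" and dec: "decaying g" "decaying g'"
  shows "strip_integral (\<lambda>p. f p * g' p) = - strip_integral (\<lambda>p. f' p * g p)"
proof -
  have "strip_integral (\<lambda>p. f p * g' p + f' p * g p) = 0"
    by (rule strip_integral_dt_eq_0[of "\<lambda>p. f p * g p"])
      (auto intro!: has_vector_derivative_mult f g decaying_add decaying_mult bdd dec simp: per)
  then show ?thesis
    by (simp add: strip_integral_add decaying_mult bdd dec eq_neg_iff_add_eq_0)
qed

lemma strip_integration_by_parts_dx:
  assumes f: "\<And>t x. ((\<lambda>y. f (t, y)) has_vector_derivative f' (t, x)) (at x)"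
    and g: "\<And>t x. ((\<lambda>y. g (t, y)) has_vector_derivative g' (t, x)) (at x)"
    and bdd: "bounded_continuous f" "bounded_continuous f'" and dec: "decaying g" "decaying g'"
  shows "strip_integral (\<lambda>p. f p * g' p) = - strip_integral (\<lambda>p. f' p * g p)"
proof -
  have "strip_integral (\<lambda>p. f p * g' p + f' p * g p) = 0"
    by (rule strip_integral_dx_eq_0[of "\<lambda>p. f p * g p"])
      (auto intro!: has_vector_derivative_mult f g decaying_add decaying_mult bdd dec)
  then show ?thesis
    by (simp add: strip_integral_add decaying_mult bdd dec eq_neg_iff_add_eq_0)
qed

lemma schwartz_decaying:
  assumes "f \<in> schwartz"
  shows "decaying f" "decaying (dt f)" "decaying (dx f)"
proof -
  have "decaying ((dt ^^ a) ((dx ^^ b) f))" for a b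
    using schwartz_weighted_bound[OF assms, of 1 a b]
      smooth_continuous[OF smooth_iterate[OF schwartz_smooth[OF assms]]]
    by (simp add: decaying_def)
  from this[of 0 0] this[of 1 0] this[of 0 1]
  show "decaying f" "decaying (dt f)" "decaying (dx f)" by simp_all
qed

section \<open>Bounded functions as tempered distributions\<close>

lemma C_diff_diff:
  "C_diff k f \<Longrightarrow> C_diff k g \<Longrightarrow> C_diff k (\<lambda>p. f p - g p)"
  and dt_diff: "smooth f \<Longrightarrow> smooth g \<Longrightarrow> dt (\<lambda>p. f p - g p) = (\<lambda>p. dt f p - dt g p)"
  and dx_diff: "smooth f \<Longrightarrow> smooth g \<Longrightarrow> dx (\<lambda>p. f p - g p) = (\<lambda>p. dx f p - dx g p)"
proof -
  have t: "(\<lambda>s. f (s, x)) differentiable (at t)" and x: "(\<lambda>y. f (t, y)) differentiable (at x)"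
    if "f differentiable_on UNIV" for f :: cyl_fun and t x
    using that differentiable_chain_at[of "\<lambda>s. (s, x)" t f] differentiable_chain_at[of "\<lambda>y. (t, y)" x f]
    by (auto simp: o_def differentiable_Pair differentiable_on_def)
  have dt: "dt (\<lambda>p. f p - g p) = (\<lambda>p. dt f p - dt g p)"
    and dx: "dx (\<lambda>p. f p - g p) = (\<lambda>p. dx f p - dx g p)"
    if "f differentiable_on UNIV" "g differentiable_on UNIV" for f g :: cyl_fun
    using that t[of f] t[of g] x[of f] x[of g] by (auto simp: dt_def dx_def fun_eq_iff)
  show "C_diff k f \<Longrightarrow> C_diff k g \<Longrightarrow> C_diff k (\<lambda>p. f p - g p)"
    by (induction k arbitrary: f g) (auto intro!: continuous_on_diff differentiable_on_diff simp: dt dx)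
  show "smooth f \<Longrightarrow> smooth g \<Longrightarrow> dt (\<lambda>p. f p - g p) = (\<lambda>p. dt f p - dt g p)"
    "smooth f \<Longrightarrow> smooth g \<Longrightarrow> dx (\<lambda>p. f p - g p) = (\<lambda>p. dx f p - dx g p)"
    using dt dx C_diff.simps(2) unfolding smooth_def by metis+
qed

lemma iterate_diff:
  assumes "smooth f" "smooth g"
  shows "(dt ^^ a) ((dx ^^ b) (\<lambda>p. f p - g p)) = (\<lambda>p. (dt ^^ a) ((dx ^^ b) f) p - (dt ^^ a) ((dx ^^ b) g) p)"
proof (induction a)
  case 0
  show ?case
  proof (induction b)
    case (Suc b)
    then show ?case
      using dx_diff[OF smooth_iterate[OF assms(1), of 0 b] smooth_iterate[OF assms(2), of 0 b]] by simp
  qed simp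
next
  case (Suc a)
  then show ?case
    using dt_diff[OF smooth_iterate[OF assms(1), of a b] smooth_iterate[OF assms(2), of a b]] by simp
qed

lemma schwartz_diff:
  assumes "f \<in> schwartz" "g \<in> schwartz"
  shows "(\<lambda>p. f p - g p) \<in> schwartz"
proof -
  have sm: "smooth f" "smooth g" using assms by (auto simp: schwartz_smooth)
  have "bdd_above (range (weighted_deriv \<alpha> \<beta> \<gamma> (\<lambda>p. f p - g p)))" for \<alpha> \<beta> \<gamma>
  proof -
    obtain M where M: "\<And>p. weighted_deriv \<alpha> \<beta> \<gamma> f p \<le> M"
      using assms(1) unfolding schwartz_def bdd_above_def by blast
    obtain N where N: "\<And>p. weighted_deriv \<alpha> \<beta> \<gamma> g p \<le> N"
      using assms(2) unfolding schwartz_def bdd_above_def by blast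
    have "weighted_deriv \<alpha> \<beta> \<gamma> (\<lambda>p. f p - g p) p \<le> M + N" for p
    proof -
      have "weighted_deriv \<alpha> \<beta> \<gamma> (\<lambda>p. f p - g p) p \<le> weighted_deriv \<alpha> \<beta> \<gamma> f p + weighted_deriv \<alpha> \<beta> \<gamma> g p"
        by (cases p) (simp add: weighted_deriv_def iterate_diff[OF sm] right_diff_distrib norm_triangle_ineq4)
      then show ?thesis using M[of p] N[of p] by simp
    qed
    then show ?thesis by (auto simp: bdd_above_def)
  qed
  moreover have "smooth (\<lambda>p. f p - g p)" using sm by (auto simp: smooth_def C_diff_diff)
  ultimately show ?thesis using assms by (auto simp: schwartz_def)
qed

lemma weighted_deriv_le_schwartz_norm:
  "f \<in> schwartz \<Longrightarrow> weighted_deriv \<alpha> \<beta> \<gamma> f p \<le> schwartz_norm \<alpha> \<beta> \<gamma> f"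
  unfolding schwartz_norm_def by (rule cSUP_upper) (auto simp: schwartz_def)

lemma schwartz_norm_nonneg: "f \<in> schwartz \<Longrightarrow> 0 \<le> schwartz_norm \<alpha> \<beta> \<gamma> f"
  by (rule order_trans[OF _ weighted_deriv_le_schwartz_norm[of f \<alpha> \<beta> \<gamma> "(0, 0)"]])
    (auto simp: weighted_deriv_def)

lemma weight_le_schwartz_seminorm:
  assumes f: "f \<in> schwartz"
  shows "(1 + x\<^sup>2) * norm (f (t, x)) \<le> schwartz_seminorm 2 f"
proof -
  have "(1 + x\<^sup>2) * norm (f (t, x)) = weighted_deriv 0 0 0 f (t, x) + weighted_deriv 0 0 2 f (t, x)"
    by (simp add: weighted_deriv_def norm_mult norm_power algebra_simps)
  also have "\<dots> \<le> schwartz_norm 0 0 0 f + schwartz_norm 0 0 2 f"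
    by (intro add_mono weighted_deriv_le_schwartz_norm f)
  also have "\<dots> = (\<Sum>(\<alpha>, \<beta>, \<gamma>) \<in> {(0, 0, 0), (0, 0, 2)}. schwartz_norm \<alpha> \<beta> \<gamma> f)" by simp
  also have "\<dots> \<le> schwartz_seminorm 2 f"
    unfolding schwartz_seminorm_def
  proof (rule sum_mono2)
    show "finite {(\<alpha>, \<beta>, \<gamma>). \<alpha> + \<beta> + \<gamma> \<le> (2::nat)}"
      by (rule finite_subset[of _ "{..2} \<times> {..2} \<times> {..2}"]) auto
  qed (auto simp: schwartz_norm_nonneg f)
  finally show ?thesis .
qed

lemma norm_strip_integral_le:
  assumes "decaying F" and M: "\<And>t x. norm (F (t, x)) \<le> M * inverse (1 + x\<^sup>2)"
  shows "norm (strip_integral F) \<le> M * (LINT p:strip|lborel. inverse (1 + (snd p)\<^sup>2))"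
proof -
  have "norm (strip_integral F) \<le> (LINT p:strip|lborel. norm (F p))"
    by (rule set_integral_norm_bound[OF decaying_integrable[OF assms(1)]])
  also have "\<dots> \<le> (LINT p:strip|lborel. M * inverse (1 + (snd p)\<^sup>2))"
    using M by (intro set_integral_mono set_integrable_norm decaying_integrable assms
        set_integrable_mult_right integrable_strip_weight) auto
  finally show ?thesis by simp
qed

text \<open>The seminorm of order two controls \<open>(1 + x\<^sup>2) \<bar>f\<bar>\<close>, and \<open>1 / (1 + x\<^sup>2)\<close> is integrable over
  the strip, so the functional is bounded by a multiple of that seminorm. Applied to differences,
  the bound shows that a preimage of an open set contains a seminorm ball around each of its points.\<close>

lemma bounded_functional_tempered:
  assumes e: "bounded_continuous e"
  shows "functional_of e \<in> tempered"
proof -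
  let ?u = "functional_of e"
  obtain B where B: "\<And>p. norm (e p) \<le> B" using e by (auto simp: bounded_continuous_def)
  have B0: "0 \<le> B" using order_trans[OF norm_ge_zero B] .
  define K where "K = B * (LINT p:strip|lborel. inverse (1 + (snd p)\<^sup>2)) + 1"
  have dec: "decaying (\<lambda>p. e p * f p)" if "f \<in> schwartz" for f
    by (intro decaying_mult e schwartz_decaying that)
  have "0 \<le> (LINT p:strip|lborel. inverse (1 + (snd p)\<^sup>2))"
    unfolding set_lebesgue_integral_def by (intro Bochner_Integration.integral_nonneg) (auto simp: add_nonneg_nonneg)
  then have K: "0 < K" using B0 by (simp add: K_def add_nonneg_pos)
  have bound: "norm (?u f) \<le> K * schwartz_seminorm 2 f" if f: "f \<in> schwartz" for f
  proof -
    have s0: "0 \<le> schwartz_seminorm 2 f"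
      using order_trans[OF _ weight_le_schwartz_seminorm[OF f, of 0 0]] by simp
    have "norm (e (t, x) * f (t, x)) \<le> (B * schwartz_seminorm 2 f) * inverse (1 + x\<^sup>2)" for t x
    proof -
      have "0 < 1 + x\<^sup>2" by (simp add: add_pos_nonneg)
      then have "norm (f (t, x)) \<le> schwartz_seminorm 2 f * inverse (1 + x\<^sup>2)"
        using weight_le_schwartz_seminorm[OF f, of x t] by (simp add: field_simps)
      then have "norm (e (t, x)) * norm (f (t, x)) \<le> B * (schwartz_seminorm 2 f * inverse (1 + x\<^sup>2))"
        using B B0 by (intro mult_mono) auto
      then show ?thesis by (simp add: norm_mult)
    qed
    from norm_strip_integral_le[OF dec[OF f] this]
    have "norm (?u f) \<le> (K - 1) * schwartz_seminorm 2 f"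
      by (simp add: functional_of_def K_def mult_ac)
    then show ?thesis using s0 by (simp add: left_diff_distrib)
  qed
  have diff: "?u g - ?u f = ?u (\<lambda>p. g p - f p)" if "f \<in> schwartz" "g \<in> schwartz" for f g
    unfolding functional_of_def
    by (subst set_integral_diff(2)[symmetric]) (auto intro!: decaying_integrable dec that simp: right_diff_distrib)
  let ?\<B> = "{{g \<in> schwartz. schwartz_seminorm N (\<lambda>p. g p - f p) < \<epsilon>} | f N \<epsilon>. f \<in> schwartz \<and> \<epsilon> > 0}"
  have zero: "schwartz_seminorm N (\<lambda>p. f p - f p) = 0" if "f \<in> schwartz" for f N
  proof -
    have "weighted_deriv \<alpha> \<beta> \<gamma> (\<lambda>p. f p - f p) p = 0" for \<alpha> \<beta> \<gamma> p
      using iterate_diff[OF schwartz_smooth[OF that] schwartz_smooth[OF that], of \<alpha> \<beta>]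
      by (cases p) (simp add: weighted_deriv_def)
    then show ?thesis by (simp add: schwartz_seminorm_def schwartz_norm_def)
  qed
  have top: "topspace schwartz_topology = schwartz"
  proof -
    have "f \<in> \<Union>?\<B>" if f: "f \<in> schwartz" for f
    proof (rule UnionI)
      show "{g \<in> schwartz. schwartz_seminorm 0 (\<lambda>p. g p - f p) < 1} \<in> ?\<B>"
        using f zero_less_one by blast
      show "f \<in> {g \<in> schwartz. schwartz_seminorm 0 (\<lambda>p. g p - f p) < 1}" using f zero[OF f, of 0] by simp
    qed
    then show ?thesis unfolding schwartz_topology_def topology_generated_by_topspace by blast
  qed
  have "continuous_map schwartz_topology euclidean ?u"
    unfolding continuous_map_def top
  proof (intro conjI allI impI)
    fix U :: "complex set" assume "openin euclidean U"
    then have U: "open U" by simp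
    show "openin schwartz_topology {f \<in> schwartz. ?u f \<in> U}"
    proof (subst openin_subopen, intro ballI)
      fix f assume "f \<in> {f \<in> schwartz. ?u f \<in> U}"
      then have f: "f \<in> schwartz" "?u f \<in> U" by auto
      then obtain \<epsilon> where \<epsilon>: "0 < \<epsilon>" "ball (?u f) \<epsilon> \<subseteq> U" using U openE by blast
      let ?V = "{g \<in> schwartz. schwartz_seminorm 2 (\<lambda>p. g p - f p) < \<epsilon> / K}"
      have "?V \<in> ?\<B>" using f \<epsilon> K by (auto intro!: exI[of _ f] exI[of _ 2] exI[of _ "\<epsilon> / K"])
      then have "openin schwartz_topology ?V"
        unfolding schwartz_topology_def by (rule topology_generated_by_Basis)
      moreover have "f \<in> ?V" using f zero[OF f(1), of 2] \<epsilon> K by simp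
      moreover have "?V \<subseteq> {f \<in> schwartz. ?u f \<in> U}"
      proof safe
        fix g assume g: "g \<in> schwartz" "schwartz_seminorm 2 (\<lambda>p. g p - f p) < \<epsilon> / K"
        have "norm (?u g - ?u f) \<le> K * schwartz_seminorm 2 (\<lambda>p. g p - f p)"
          unfolding diff[OF f(1) g(1)] by (intro bound schwartz_diff f g)
        also have "\<dots> < \<epsilon>" using g(2) K by (simp add: field_simps)
        finally have "?u g \<in> ball (?u f) \<epsilon>" by (simp add: dist_norm norm_minus_commute)
        then show "?u g \<in> U" using \<epsilon> by blast
      qed
      ultimately show "\<exists>T. openin schwartz_topology T \<and> f \<in> T \<and> T \<subseteq> {f \<in> schwartz. ?u f \<in> U}" by blast
    qed
  qed auto
  moreover have "?u (\<lambda>p. f p + g p) = ?u f + ?u g" if "f \<in> schwartz" "g \<in> schwartz" for f g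
    using strip_integral_add[OF dec[OF that(1)] dec[OF that(2)]]
    by (simp add: functional_of_def distrib_left)
  moreover have "?u (\<lambda>p. a * f p) = a * ?u f" for a f
    by (simp add: functional_of_def mult.left_commute)
  ultimately show ?thesis by (simp add: tempered_def)
qed

section \<open>Fourier series of periodic functions\<close>

lemma has_vector_derivative_cis:
  "((\<lambda>t. cis (c * t)) has_vector_derivative (\<i> * of_real c * cis (c * t))) (at t within S)"
proof -
  have "((\<lambda>z. exp (\<i> * of_real c * z)) has_field_derivative
      exp (\<i> * of_real c * of_real t) * (\<i> * of_real c)) (at (of_real t))"
    by (auto intro!: derivative_eq_intros)
  from has_vector_derivative_real_field[OF this, of S] show ?thesis
    by (simp add: cis_conv_exp mult_ac)
qed

lemma cis_int_periodic: "cis (of_int k * (t + 2 * pi)) = cis (of_int k * t)"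
proof -
  have "cis (of_int k * (t + 2 * pi)) = cis (of_int k * t) * cis (2 * pi * of_int k)"
    by (simp only: cis_mult) (simp add: algebra_simps)
  then show ?thesis by simp
qed

lemma continuous_on_cis_mult [continuous_intros]:
  "continuous_on A f \<Longrightarrow> continuous_on A (\<lambda>t. cis (f t))"
  unfolding cis_conv_exp by (intro continuous_intros)

definition fourier_coeff :: "(real \<Rightarrow> complex) \<Rightarrow> int \<Rightarrow> complex" where
  "fourier_coeff g k = integral {0..2 * pi} (\<lambda>t. g t * cis (- (of_int k * t))) / of_real (2 * pi)"

lemma integral_fourier_kernel:
  "integral {0..2 * pi} (\<lambda>t. g t * cis (- (of_int k * t))) = 2 * pi * fourier_coeff g k"
  by (simp add: fourier_coeff_def)

lemma norm_fourier_coeff_le: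
  assumes "continuous_on UNIV g" "\<And>t. norm (g t) \<le> M"
  shows "norm (fourier_coeff g k) \<le> M"
proof -
  have "norm (integral {0..2 * pi} (\<lambda>t. g t * cis (- (of_int k * t)))) \<le> M * (2 * pi - 0)"
    using assms by (intro integral_bound)
      (auto intro!: continuous_intros continuous_on_subset[OF assms(1)] simp: norm_mult)
  then show ?thesis
    by (simp add: fourier_coeff_def norm_divide norm_mult field_simps)
qed

text \<open>Integration by parts; the boundary terms cancel by periodicity.\<close>

lemma fourier_coeff_derivative:
  assumes g: "\<And>t. (g has_vector_derivative g' t) (at t)"
    and cont: "continuous_on UNIV g'" and per: "\<And>t. g (t + 2 * pi) = g t"
  shows "fourier_coeff g' k = \<i> * of_int k * fourier_coeff g k"
proof -
  define e where "e t = cis (- (of_int k * t))" for t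
  have e: "(e has_vector_derivative - \<i> * of_int k * e t) (at t)" for t
    unfolding e_def using has_vector_derivative_cis[of "- of_int k" t UNIV] by simp
  have contg: "continuous_on UNIV g"
    using g by (intro continuous_at_imp_continuous_on) (auto intro: has_vector_derivative_continuous)
  have conte: "continuous_on UNIV e" unfolding e_def by (intro continuous_intros)
  have "((\<lambda>t. g t * (- \<i> * of_int k * e t) + g' t * e t) has_integral
      g (2 * pi) * e (2 * pi) - g 0 * e 0) {0..2 * pi}"
    by (rule fundamental_theorem_of_calculus[OF _ has_vector_derivative_at_within[OF has_vector_derivative_mult[OF g e]]]) simp
  moreover have "g (2 * pi) * e (2 * pi) - g 0 * e 0 = 0"
    using per[of 0] cis_int_periodic[of "-k" 0] by (simp add: e_def)
  ultimately have "integral {0..2 * pi} (\<lambda>t. g t * (- \<i> * of_int k * e t) + g' t * e t) = 0"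
    by (simp add: integral_unique)
  moreover have "integral {0..2 * pi} (\<lambda>t. g t * (- \<i> * of_int k * e t) + g' t * e t) =
      integral {0..2 * pi} (\<lambda>t. - \<i> * of_int k * (g t * e t)) + integral {0..2 * pi} (\<lambda>t. g' t * e t)"
    by (subst integral_add[symmetric])
      (auto intro!: integrable_continuous_real continuous_intros continuous_on_subset[OF contg]
         continuous_on_subset[OF cont] continuous_on_subset[OF conte] simp: mult_ac)
  ultimately have "integral {0..2 * pi} (\<lambda>t. g' t * e t) = \<i> * of_int k * integral {0..2 * pi} (\<lambda>t. g t * e t)"
    by simp
  then show ?thesis by (simp add: fourier_coeff_def e_def)
qed

lemma integral_cis_int:
  "integral {0..2 * pi} (\<lambda>t. cis (of_int m * t)) = (if m = 0 then 2 * pi else 0)"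
proof (cases "m = 0")
  case False
  have "((\<lambda>t. \<i> * of_int m * cis (of_int m * t)) has_integral
      cis (of_int m * (2 * pi)) - cis (of_int m * 0)) {0..2 * pi}"
    using has_vector_derivative_cis[of "of_int m"]
    by (intro fundamental_theorem_of_calculus) auto
  from integral_unique[OF this] have "integral {0..2 * pi} (\<lambda>t. \<i> * of_int m * cis (of_int m * t)) = 0"
    using cis_int_periodic[of m 0] by (simp only: add_0_left mult_zero_right diff_self)
  then show ?thesis using False by simp
qed (simp add: scaleR_conv_of_real)

text \<open>The partial sum \<open>S\<close> is the orthogonal projection of \<open>g\<close>: the remainder \<open>g - S\<close> is orthogonal to
  every mode in \<open>K\<close>, and expanding \<open>0 \<le> \<integral> \<bar>g - S\<bar>\<^sup>2\<close> gives the inequality.\<close>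

lemma bessel_inequality:
  assumes cont: "continuous_on UNIV g" and "finite K"
  shows "2 * pi * (\<Sum>k\<in>K. (norm (fourier_coeff g k))\<^sup>2) \<le> integral {0..2 * pi} (\<lambda>t. (norm (g t))\<^sup>2)"
proof -
  let ?I = "\<lambda>f :: real \<Rightarrow> complex. integral {0..2 * pi} f"
  define c where "c = fourier_coeff g"
  define S where "S t = (\<Sum>k\<in>K. c k * cis (of_int k * t))" for t
  have integral_complex_of_real: "complex_of_real (integral {0..2 * pi} f) = ?I (\<lambda>t. complex_of_real (f t))"
    if "continuous_on UNIV f" for f :: "real \<Rightarrow> real"
    using integral_linear[OF integrable_continuous_real[OF continuous_on_subset[OF that]] bounded_linear_of_real[where ?'a = complex], of 0 "2 * pi"]
    by (simp add: o_def)
  note conts = continuous_on_subset[OF cont subset_UNIV]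
  have contS: "continuous_on A S" for A
    unfolding S_def by (intro continuous_intros)
  note int = integrable_continuous_real continuous_intros conts contS
  have orth: "?I (\<lambda>t. (g t - S t) * cis (- (of_int k * t))) = 0" if "k \<in> K" for k
  proof -
    have "?I (\<lambda>t. S t * cis (- (of_int k * t))) = ?I (\<lambda>t. \<Sum>j\<in>K. c j * cis (of_int (j - k) * t))"
      by (simp add: S_def sum_distrib_right cis_mult mult.assoc left_diff_distrib)
    also have "\<dots> = (\<Sum>j\<in>K. c j * (if j = k then 2 * pi else 0))"
      using \<open>finite K\<close> by (subst integral_sum) (auto intro!: int simp: integral_cis_int simp del: of_int_diff cong: if_cong)
    also have "\<dots> = 2 * pi * c k"
      using that \<open>finite K\<close> by (simp add: if_distrib[of "(*) _"] if_distrib[of of_real] cong: if_cong)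
    finally have "?I (\<lambda>t. S t * cis (- (of_int k * t))) = 2 * pi * c k" .
    then show ?thesis
      by (simp add: left_diff_distrib, subst integral_diff)
        (auto intro!: int simp: integral_fourier_kernel c_def)
  qed
  have orthS: "?I (\<lambda>t. (g t - S t) * cnj (S t)) = 0"
  proof -
    have cnjS: "cnj (S t) = (\<Sum>k\<in>K. cnj (c k) * cis (- (of_int k * t)))" for t
      by (simp add: S_def cis_cnj)
    have "?I (\<lambda>t. (g t - S t) * cnj (S t)) =
        ?I (\<lambda>t. \<Sum>k\<in>K. cnj (c k) * ((g t - S t) * cis (- (of_int k * t))))"
      unfolding cnjS sum_distrib_left by (simp only: mult.left_commute)
    also have "\<dots> = 0"
      using \<open>finite K\<close> by (subst integral_sum) (auto intro!: int simp: orth)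
    finally show ?thesis .
  qed
  have gcnj: "?I (\<lambda>t. S t * cnj (g t)) = 2 * pi * (\<Sum>k\<in>K. (norm (c k))\<^sup>2)"
  proof -
    have "?I (\<lambda>t. cis (of_int k * t) * cnj (g t)) = cnj (2 * pi * c k)" for k
      unfolding c_def integral_fourier_kernel[symmetric] integral_cnj
      by (simp add: cis_cnj mult.commute)
    then have "?I (\<lambda>t. S t * cnj (g t)) = (\<Sum>k\<in>K. c k * cnj (2 * pi * c k))"
      using \<open>finite K\<close> unfolding S_def sum_distrib_right mult.assoc
      by (subst integral_sum) (auto intro!: int)
    moreover have "c k * cnj (2 * pi * c k) = 2 * pi * (norm (c k))\<^sup>2" for k
      by (simp add: complex_norm_square del: of_real_power)
    ultimately show ?thesis
      by (simp only: sum_distrib_left of_real_sum of_real_mult of_real_numeral)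
  qed
  have "of_real (integral {0..2 * pi} (\<lambda>t. (norm (g t - S t))\<^sup>2)) = ?I (\<lambda>t. of_real ((norm (g t - S t))\<^sup>2))"
    by (rule integral_complex_of_real) (intro continuous_intros cont contS)
  also have "\<dots> = ?I (\<lambda>t. (g t * cnj (g t) - S t * cnj (g t)) - (g t - S t) * cnj (S t))"
    by (simp only: complex_norm_square complex_cnj_diff) (simp add: algebra_simps)
  also have "\<dots> = ?I (\<lambda>t. g t * cnj (g t)) - 2 * pi * (\<Sum>k\<in>K. (norm (c k))\<^sup>2)"
    by (subst integral_diff, (auto intro!: int)[2], subst integral_diff) (auto intro!: int simp: orthS gcnj)
  also have "?I (\<lambda>t. g t * cnj (g t)) = of_real (integral {0..2 * pi} (\<lambda>t. (norm (g t))\<^sup>2))"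
    by (subst integral_complex_of_real) (auto intro!: continuous_intros cont simp: complex_norm_square simp del: of_real_power)
  finally have "complex_of_real (integral {0..2 * pi} (\<lambda>t. (norm (g t - S t))\<^sup>2)) =
      complex_of_real (integral {0..2 * pi} (\<lambda>t. (norm (g t))\<^sup>2) - 2 * pi * (\<Sum>k\<in>K. (norm (c k))\<^sup>2))"
    by simp
  then have "integral {0..2 * pi} (\<lambda>t. (norm (g t - S t))\<^sup>2) =
      integral {0..2 * pi} (\<lambda>t. (norm (g t))\<^sup>2) - 2 * pi * (\<Sum>k\<in>K. (norm (c k))\<^sup>2)"
    by (simp only: of_real_eq_iff)
  moreover have "0 \<le> integral {0..2 * pi} (\<lambda>t. (norm (g t - S t))\<^sup>2)"
    by (intro integral_nonneg) (auto intro!: int)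
  ultimately show ?thesis by (simp add: c_def)
qed

lemma fourier_coeff_tendsto_0:
  assumes cont: "continuous_on UNIV g" and "inj \<phi>"
  shows "(\<lambda>n::nat. fourier_coeff g (\<phi> n)) \<longlonglongrightarrow> 0"
proof -
  have "summable (\<lambda>n. (norm (fourier_coeff g (\<phi> n)))\<^sup>2)"
  proof (rule bounded_imp_summable)
    show "(\<Sum>k\<le>n. (norm (fourier_coeff g (\<phi> k)))\<^sup>2) \<le>
        integral {0..2 * pi} (\<lambda>t. (norm (g t))\<^sup>2) / (2 * pi)" for n
      using bessel_inequality[OF cont, of "\<phi> ` {..n}"] \<open>inj \<phi>\<close>
      by (simp add: sum.reindex inj_on_subset[OF _ subset_UNIV] field_simps)
  qed auto
  then have "(\<lambda>n. (norm (fourier_coeff g (\<phi> n)))\<^sup>2) \<longlonglongrightarrow> 0"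
    by (rule summable_LIMSEQ_zero)
  then have "(\<lambda>n. sqrt ((norm (fourier_coeff g (\<phi> n)))\<^sup>2)) \<longlonglongrightarrow> sqrt 0"
    by (intro tendsto_real_sqrt)
  then show ?thesis by (simp add: tendsto_norm_zero_iff)
qed

text \<open>The quotient of two such difference quotients is how \<open>(g - g t0) / (cis (t - t0) - 1)\<close> is
  extended continuously across the zeros of its denominator in the proof of \<open>fourier_series_sums\<close>.\<close>

lemma has_vector_derivative_quotient_tendsto:
  fixes f :: "real \<Rightarrow> complex"
  assumes "(f has_vector_derivative D) (at a)"
  shows "((\<lambda>t. (f t - f a) / of_real (t - a)) \<longlongrightarrow> D) (at a)"
proof -
  have "((\<lambda>t. (f t - f a - (t - a) *\<^sub>R D) /\<^sub>R norm (t - a)) \<longlongrightarrow> 0) (at a)"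
    using assms unfolding has_vector_derivative_def has_derivative_at_within by simp
  then have "((\<lambda>t. norm ((f t - f a - (t - a) *\<^sub>R D) /\<^sub>R norm (t - a))) \<longlongrightarrow> 0) (at a)"
    by (rule tendsto_norm_zero)
  also have "?this \<longleftrightarrow> ((\<lambda>t. norm ((f t - f a) / of_real (t - a) - D)) \<longlongrightarrow> 0) (at a)"
  proof (rule tendsto_cong, rule eventually_at_filter[THEN iffD2], rule always_eventually, safe)
    fix t assume "t \<noteq> a"
    then have *: "(f t - f a) / of_real (t - a) - D = (f t - f a - (t - a) *\<^sub>R D) / of_real (t - a)"
      by (simp add: diff_divide_distrib scaleR_conv_of_real flip: of_real_diff)
    show "norm ((f t - f a - (t - a) *\<^sub>R D) /\<^sub>R norm (t - a)) = norm ((f t - f a) / of_real (t - a) - D)"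
      unfolding * norm_divide norm_of_real by (simp add: divide_inverse mult.commute)
  qed
  finally show ?thesis
    by (simp add: tendsto_norm_zero_iff LIM_zero_iff)
qed

lemma cis_eq_1_imp_periodic_eq:
  assumes per: "\<And>t. g (t + 2 * pi) = g t" and "cis (t - s) = 1"
  shows "g t = g s"
proof -
  interpret periodic_fun_simple g "2 * pi" by standard (rule per)
  have "cos (t - s) = 1" using assms(2) by (simp add: complex_eq_iff)
  then obtain n :: int where "t - s = of_int n * 2 * pi" using cos_one_2pi_int by blast
  then have "t = s + of_int n * (2 * pi)" by simp
  then show ?thesis using plus_of_int[of s n] by simp
qed

text \<open>Dividing \<open>g - g t0\<close> by \<open>cis (t - t0) - 1\<close>, which shifts Fourier indices by one, makes the
  symmetric partial sums at \<open>t0\<close> telescope; what is left over are two coefficients of the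
  quotient, and these tend to zero by Bessel's inequality.\<close>

lemma fourier_series_sums:
  assumes g: "\<And>t. (g has_vector_derivative g' t) (at t)"
    and per: "\<And>t. g (t + 2 * pi) = g t"
  shows "(\<lambda>n. fourier_coeff g (int n) * cis (of_int (int n) * t0) +
      fourier_coeff g (- int n - 1) * cis (of_int (- int n - 1) * t0)) sums g t0"
proof -
  (* at the points t0 + 2 pi m the quotient is 0 / 0 and gets its limit as value *)
  define G where "G t = (if cis (t - t0) = 1 then g' t / \<i> else (g t - g t0) / (cis (t - t0) - 1))" for t
  have contg: "continuous_on UNIV g"
    using g by (intro continuous_at_imp_continuous_on) (auto intro: has_vector_derivative_continuous)
  have contc: "continuous_on UNIV (\<lambda>t. cis (t - t0))" by (intro continuous_intros)
  have "isCont G t1" for t1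
  proof (cases "cis (t1 - t0) = 1")
    case False
    have "open {t. cis (t - t0) \<noteq> 1}"
      using open_Collect_neq[OF contc continuous_on_const] by simp
    then have ev: "eventually (\<lambda>t. cis (t - t0) \<noteq> 1) (nhds t1)"
      using False eventually_nhds_in_open by fastforce
    have "isCont (\<lambda>t. (g t - g t0) / (cis (t - t0) - 1)) t1"
      using contg contc False by (intro continuous_intros) (auto simp: continuous_on_eq_continuous_at)
    moreover have "eventually (\<lambda>t. G t = (g t - g t0) / (cis (t - t0) - 1)) (nhds t1)"
      using ev by eventually_elim (simp add: G_def)
    ultimately show ?thesis using isCont_cong by force
  next
    case True
    then have gt: "g t1 = g t0" by (rule cis_eq_1_imp_periodic_eq[of g, OF per])
    have cis: "cis (t - t0) = cis (t - t1)" for t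
      using True cis_mult[of "t - t1" "t1 - t0"] by simp
    have "((\<lambda>t. cis (t - t1)) has_vector_derivative \<i>) (at t1)"
      using has_vector_derivative_cis[of 1 0 UNIV]
        vector_diff_chain_at[of "\<lambda>t. t - t1" 1 t1 cis \<i>]
      by (simp add: o_def has_vector_derivative_diff_const has_vector_derivative_id)
    from has_vector_derivative_quotient_tendsto[OF this]
    have lim: "((\<lambda>t. (cis (t - t0) - 1) / of_real (t - t1)) \<longlongrightarrow> \<i>) (at t1)"
      by (simp add: cis)
    have "eventually (\<lambda>t. (cis (t - t0) - 1) / of_real (t - t1) \<noteq> 0) (at t1)"
      by (rule tendsto_imp_eventually_ne[OF lim]) simp
    then have "eventually (\<lambda>t. ((g t - g t1) / of_real (t - t1)) / ((cis (t - t0) - 1) / of_real (t - t1)) = G t) (at t1)"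
      by eventually_elim (auto simp: G_def gt)
    moreover have "((\<lambda>t. ((g t - g t1) / of_real (t - t1)) / ((cis (t - t0) - 1) / of_real (t - t1)))
        \<longlongrightarrow> g' t1 / \<i>) (at t1)"
      by (intro tendsto_divide has_vector_derivative_quotient_tendsto g lim) auto
    ultimately have "(G \<longlongrightarrow> g' t1 / \<i>) (at t1)"
      using tendsto_cong by fastforce
    then show ?thesis using True by (simp add: isCont_def G_def)
  qed
  then have contG: "continuous_on UNIV G" by (simp add: continuous_on_eq_continuous_at)
  define b where "b k = fourier_coeff G k * cis (of_int k * t0)" for k
  have coeff: "fourier_coeff g k * cis (of_int k * t0) = (if k = 0 then g t0 else 0) + b (k - 1) - b k" for k
  proof -
    have g_eq: "g t = g t0 + G t * (cis (t - t0) - 1)" for t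
      using cis_eq_1_imp_periodic_eq[of g, OF per, of t t0] by (simp add: G_def)
    have shift: "cis (t - t0) * cis (- (of_int k * t)) = cis (- t0) * cis (- (of_int (k - 1) * t))" for t
      by (simp add: cis_mult algebra_simps)
    have eq: "g t * cis (- (of_int k * t)) = g t0 * cis (of_int (-k) * t) +
        (cis (- t0) * (G t * cis (- (of_int (k - 1) * t))) - G t * cis (- (of_int k * t)))" for t
      unfolding g_eq[of t] by (simp add: shift ring_distribs mult.left_commute del: of_int_diff)
    have "2 * pi * fourier_coeff g k = g t0 * (if k = 0 then 2 * pi else 0) +
        (cis (- t0) * (2 * pi * fourier_coeff G (k - 1)) - 2 * pi * fourier_coeff G k)"
      unfolding integral_fourier_kernel[symmetric] eq
      by (subst integral_add, (auto intro!: integrable_continuous_real continuous_intros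
            continuous_on_subset[OF contG] simp del: of_int_diff)[2],
          subst integral_diff, (auto intro!: integrable_continuous_real continuous_intros
            continuous_on_subset[OF contG] simp del: of_int_diff)[2])
        (simp add: integral_cis_int del: of_int_minus of_int_diff)
    then have "2 * pi * fourier_coeff g k = 2 * pi * ((if k = 0 then g t0 else 0) +
        cis (- t0) * fourier_coeff G (k - 1) - fourier_coeff G k)"
      by (simp add: algebra_simps)
    then have "fourier_coeff g k = (if k = 0 then g t0 else 0) +
        cis (- t0) * fourier_coeff G (k - 1) - fourier_coeff G k"
      by (simp only: mult_cancel_left) simp
    then have "fourier_coeff g k * cis (of_int k * t0) = (if k = 0 then g t0 else 0) * cis (of_int k * t0) +
        fourier_coeff G (k - 1) * (cis (- t0) * cis (of_int k * t0)) - fourier_coeff G k * cis (of_int k * t0)"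
      by (simp only: ring_distribs mult_ac)
    also have "cis (- t0) * cis (of_int k * t0) = cis (of_int (k - 1) * t0)"
      by (simp add: cis_mult algebra_simps)
    finally show ?thesis by (simp add: b_def)
  qed
  (* the n-th term contributes the modes n and - n - 1, so both ends of the index range telescope *)
  have partial: "(\<Sum>n<N. fourier_coeff g (int n) * cis (of_int (int n) * t0) +
      fourier_coeff g (- int n - 1) * cis (of_int (- int n - 1) * t0)) =
      (if N = 0 then 0 else g t0) - b (int N - 1) + b (- int N - 1)" for N
    by (induction N) (simp_all only: sum.lessThan_Suc coeff, auto simp: algebra_simps)
  have b0: "(\<lambda>n. b (\<phi> n)) \<longlonglongrightarrow> 0" if "inj \<phi>" for \<phi> :: "nat \<Rightarrow> int"
    using tendsto_norm[OF fourier_coeff_tendsto_0[OF contG that]]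
    by (subst tendsto_norm_zero_iff[symmetric]) (simp add: b_def norm_mult)
  have "(\<lambda>N. g t0 - b (int N - 1) + b (- int N - 1)) \<longlonglongrightarrow> g t0 - 0 + 0"
    by (intro tendsto_add tendsto_diff tendsto_const b0[of "\<lambda>N. int N - 1"] b0[of "\<lambda>N. - int N - 1"])
      (auto simp: inj_def)
  moreover have "eventually (\<lambda>N. g t0 - b (int N - 1) + b (- int N - 1) =
      (if N = 0 then 0 else g t0) - b (int N - 1) + b (- int N - 1)) sequentially"
    using eventually_gt_at_top[of 0] by eventually_elim simp
  ultimately have "(\<lambda>N. (if N = 0 then 0 else g t0) - b (int N - 1) + b (- int N - 1)) \<longlonglongrightarrow> g t0 - 0 + 0"
    by (rule Lim_transform_eventually)
  then show ?thesis unfolding sums_def partial by simp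
qed

section \<open>The first-order equation on the line\<close>

text \<open>The logarithmic derivative of the weight \<open>(A\<^sup>2 + x\<^sup>2) ^ n\<close> is at most \<open>n / A \<le> \<delta> / 2\<close>, so for
  \<open>r \<ge> \<delta>\<close> the function \<open>exp (r x) / (A\<^sup>2 + x\<^sup>2) ^ n\<close> grows at least at the rate \<open>\<delta> / 2\<close>. Its multiple
  by \<open>2 M / \<delta>\<close> is the comparison function for the weighted estimate.\<close>

lemma growth_comparison_derivative:
  fixes \<delta> r A :: real
  assumes \<delta>: "0 < \<delta>" "\<delta> \<le> r" and A: "1 \<le> A" "2 * real n / \<delta> \<le> A" and "0 \<le> M"
  defines "\<rho> \<equiv> \<lambda>x. (A\<^sup>2 + x\<^sup>2) ^ n"
  shows "\<exists>d. ((\<lambda>x. 2 * M / \<delta> * exp (r * x) / \<rho> x) has_vector_derivative d) (at x) \<and>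
    M * exp (r * x) / \<rho> x \<le> d"
proof (intro exI conjI)
  define q where "q = A\<^sup>2 + x\<^sup>2"
  have q: "0 < q" using A by (simp add: q_def add_pos_nonneg)
  define d where "d = 2 * M / \<delta> * (exp (r * x) / q ^ n) * (r - real n * (2 * x) / q)"
  have "((\<lambda>x. 2 * M / \<delta> * exp (r * x) / (A\<^sup>2 + x\<^sup>2) ^ n) has_real_derivative d) (at x)"
  proof -
    have 1: "((\<lambda>x. A\<^sup>2 + x\<^sup>2) has_real_derivative 2 * x) (at x)"
      by (auto intro!: derivative_eq_intros)
    have 2: "((\<lambda>x. 2 * M / \<delta> * exp (r * x)) has_real_derivative 2 * M / \<delta> * (exp (r * x) * r)) (at x)"
      using \<delta> by (auto intro!: derivative_eq_intros)
    have "((\<lambda>x. 2 * M / \<delta> * exp (r * x) / (A\<^sup>2 + x\<^sup>2) ^ n) has_real_derivative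
        (2 * M / \<delta> * (exp (r * x) * r) * q ^ n -
          2 * M / \<delta> * exp (r * x) * (real n * (2 * x * q ^ (n - Suc 0)))) / (q ^ n * q ^ n)) (at x)"
      unfolding q_def by (rule DERIV_divide[OF 2 DERIV_power[OF 1]]) (use q in \<open>auto simp: q_def\<close>)
    also have "(2 * M / \<delta> * (exp (r * x) * r) * q ^ n -
        2 * M / \<delta> * exp (r * x) * (real n * (2 * x * q ^ (n - Suc 0)))) / (q ^ n * q ^ n) = d"
      using q \<delta> by (cases n) (simp_all add: d_def field_simps)
    finally show ?thesis .
  qed
  then show "((\<lambda>x. 2 * M / \<delta> * exp (r * x) / \<rho> x) has_vector_derivative d) (at x)"
    by (simp add: \<rho>_def has_real_derivative_iff_has_vector_derivative)
  have "A * (2 * x) \<le> q"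
    using sum_squares_bound[of A x] by (simp add: q_def power2_eq_square mult_ac)
  then have "2 * x / q \<le> 1 / A" using q A by (simp add: field_simps)
  then have "real n * (2 * x / q) \<le> real n * (1 / A)" by (intro mult_left_mono) auto
  also have "\<dots> \<le> \<delta> / 2" using A \<delta> by (simp add: field_simps)
  finally have "\<delta> / 2 \<le> r - real n * (2 * x) / q" using \<delta> by simp
  then have "2 * M / \<delta> * (exp (r * x) / q ^ n) * (\<delta> / 2) \<le> d"
    unfolding d_def using q \<delta> \<open>0 \<le> M\<close> by (intro mult_left_mono) auto
  then show "M * exp (r * x) / \<rho> x \<le> d"
    using \<delta> by (simp add: \<rho>_def q_def)
qed

text \<open>The form of the mean value inequality used for all estimates on the line: the comparison
  function \<open>\<phi>\<close> stands in for the integral of \<open>\<bar>v'\<bar>\<close>, and letting \<open>a\<close> tend to \<open>-\<infinity>\<close> bounds \<open>v\<close> itself.\<close>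

lemma increment_le_of_derivative_comparison:
  fixes v :: "real \<Rightarrow> complex"
  assumes "\<And>x. (v has_vector_derivative v' x) (at x)"
    and "\<And>x. \<exists>d. (\<phi> has_vector_derivative d) (at x) \<and> norm (v' x) \<le> d"
    and "a \<le> b"
  shows "norm (v b - v a) \<le> \<phi> b - \<phi> a"
proof (cases "a = b")
  case False
  obtain \<phi>' where \<phi>': "\<And>x. (\<phi> has_vector_derivative \<phi>' x) (at x)" "\<And>x. norm (v' x) \<le> \<phi>' x"
    using assms(2) by metis
  show ?thesis
    by (rule differentiable_bound_general[OF _ _ _ assms(1) \<phi>'])
      (use False assms in \<open>auto intro!: continuous_at_imp_continuous_on
        has_vector_derivative_continuous[OF assms(1)] has_vector_derivative_continuous[OF \<phi>'(1)]\<close>)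
qed simp

lemma has_vector_derivative_exp_mult:
  fixes z :: complex
  shows "((\<lambda>x. exp (z * of_real x)) has_vector_derivative (z * exp (z * of_real x))) (at x within S)"
proof -
  have "((\<lambda>w. exp (z * w)) has_field_derivative exp (z * of_real x) * z) (at (of_real x))"
    by (auto intro!: derivative_eq_intros)
  from has_vector_derivative_real_field[OF this, of S] show ?thesis by (simp add: mult.commute)
qed

lemma exp_mult_tendsto_0_at_bot:
  "0 < (r::real) \<Longrightarrow> ((\<lambda>y. exp (r * y)) \<longlongrightarrow> 0) at_bot"
  by (rule filterlim_compose[OF exp_at_bot])
    (simp add: filterlim_tendsto_pos_mult_at_bot[OF tendsto_const _ filterlim_ident])

text \<open>With \<open>v = exp (\<mu> x) w\<close> the equation reads \<open>v' = exp (\<mu> x) h\<close>; as \<open>w\<close> is bounded, \<open>v\<close> vanishes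
  at \<open>-\<infinity>\<close>, so integrating the comparison from there bounds it.\<close>

lemma bounded_solution_weighted_bound_pos:
  fixes w h :: "real \<Rightarrow> complex"
  assumes \<delta>: "0 < \<delta>" "\<delta> \<le> Re \<mu>" and A: "1 \<le> A" "2 * real n / \<delta> \<le> A"
    and ode: "\<And>x. (w has_vector_derivative (h x - \<mu> * w x)) (at x)"
    and bdd: "\<And>x. norm (w x) \<le> B"
    and h: "\<And>x. (A\<^sup>2 + x\<^sup>2) ^ n * norm (h x) \<le> M"
  shows "(A\<^sup>2 + x\<^sup>2) ^ n * norm (w x) \<le> 2 * M / \<delta>"
proof -
  define r where "r = Re \<mu>"
  define \<rho> where "\<rho> x = (A\<^sup>2 + x\<^sup>2) ^ n" for x
  define \<phi> where "\<phi> x = 2 * M / \<delta> * exp (r * x) / \<rho> x" for x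
  define v where "v x = exp (\<mu> * of_real x) * w x" for x
  have \<rho>: "0 < \<rho> x" for x using A by (simp add: \<rho>_def add_pos_nonneg)
  have M: "0 \<le> M" using order_trans[OF _ h[of 0]] by simp
  have \<phi>0: "0 \<le> \<phi> x" for x using M \<delta> \<rho>[of x] by (simp add: \<phi>_def)
  have v': "(v has_vector_derivative exp (\<mu> * of_real x) * h x) (at x)" for x
    unfolding v_def
    using has_vector_derivative_mult[OF has_vector_derivative_exp_mult[of \<mu>] ode]
    by (simp add: algebra_simps)
  have nv: "norm (exp (\<mu> * of_real x) * z) = exp (r * x) * norm z" for x z
    by (simp add: norm_mult norm_exp_eq_Re r_def)
  have le: "norm (v x - v y) \<le> \<phi> x" if "y \<le> x" for y
  proof -
    have "norm (v x - v y) \<le> \<phi> x - \<phi> y"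
    proof (rule increment_le_of_derivative_comparison[OF v' _ that])
      fix x
      obtain d where d: "(\<phi> has_vector_derivative d) (at x)" "M * exp (r * x) / \<rho> x \<le> d"
        using growth_comparison_derivative[OF \<delta>(1) _ A M, of r x] \<delta>(2)
        unfolding \<phi>_def \<rho>_def r_def by blast
      have "norm (h x) \<le> M / \<rho> x"
        using h[of x] \<rho>[of x] by (simp add: \<rho>_def field_simps)
      then have "exp (r * x) * norm (h x) \<le> exp (r * x) * (M / \<rho> x)" by (intro mult_left_mono) auto
      then show "\<exists>d. (\<phi> has_vector_derivative d) (at x) \<and> norm (exp (\<mu> * of_real x) * h x) \<le> d"
        using d unfolding nv by (intro exI[of _ d]) (auto simp: mult.commute)
    qed
    then show ?thesis using \<phi>0[of y] by simp
  qed
  have "((\<lambda>y. exp (r * y) * B) \<longlongrightarrow> 0) at_bot"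
    using exp_mult_tendsto_0_at_bot[of r] \<delta> tendsto_mult_left_zero by (auto simp: r_def)
  then have "(v \<longlongrightarrow> 0) at_bot"
    by (rule Lim_null_comparison[rotated])
      (auto intro!: always_eventually mult_left_mono bdd simp: v_def nv)
  then have "((\<lambda>y. norm (v x - v y)) \<longlongrightarrow> norm (v x - 0)) at_bot"
    by (intro tendsto_intros)
  then have "norm (v x - 0) \<le> \<phi> x"
    by (rule tendsto_upperbound) (auto intro!: eventually_mono[OF eventually_le_at_bot[of x]] le)
  then have "exp (r * x) * norm (w x) \<le> exp (r * x) * (2 * M / \<delta> / \<rho> x)"
    unfolding v_def diff_0_right nv by (simp add: \<phi>_def mult_ac)
  then have "norm (w x) \<le> 2 * M / \<delta> / \<rho> x"
    by (simp only: mult_le_cancel_left_pos exp_gt_zero)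
  then show ?thesis
    unfolding pos_le_divide_eq[OF \<rho>] by (simp add: \<rho>_def mult.commute)
qed

text \<open>An antiderivative of \<open>exp (\<mu> x) h\<close> has a limit at \<open>-\<infinity>\<close>; normalising this limit to zero selects
  the one solution that does not blow up there.\<close>

lemma bounded_solution_exists_pos:
  fixes h :: "real \<Rightarrow> complex"
  assumes "0 < Re \<mu>" and cont: "continuous_on UNIV h" and h: "\<And>x. norm (h x) \<le> M"
  shows "\<exists>w B. (\<forall>x. (w has_vector_derivative (h x - \<mu> * w x)) (at x)) \<and> (\<forall>x. norm (w x) \<le> B)"
proof -
  define r where "r = Re \<mu>"
  have r: "0 < r" using assms(1) by (simp add: r_def)
  define E where "E x = exp (\<mu> * of_real x) * h x" for x
  define \<phi> where "\<phi> x = M / r * exp (r * x)" for x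
  have M: "0 \<le> M" using order_trans[OF norm_ge_zero h] .
  have contE: "continuous_on UNIV E" unfolding E_def by (intro continuous_intros cont)
  obtain P where P: "\<And>x. (P has_vector_derivative E x) (at x)"
    using einterval_antiderivative[of "-\<infinity>" \<infinity> E] contE
    by (auto simp: continuous_on_eq_continuous_at)
  have le: "norm (P x - P y) \<le> \<phi> x - \<phi> y" if "y \<le> x" for x y
  proof (rule increment_le_of_derivative_comparison[OF P _ that])
    fix x
    have "(\<phi> has_real_derivative M * exp (r * x)) (at x)"
      unfolding \<phi>_def using r by (auto intro!: derivative_eq_intros)
    moreover have "norm (E x) \<le> M * exp (r * x)"
      using mult_left_mono[OF h, of "exp (r * x)" x]
      by (simp add: E_def norm_mult norm_exp_eq_Re r_def mult.commute)
    ultimately show "\<exists>d. (\<phi> has_vector_derivative d) (at x) \<and> norm (E x) \<le> d"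
      by (auto simp: has_real_derivative_iff_has_vector_derivative)
  qed
  have \<phi>0: "0 \<le> \<phi> x" for x using M r by (simp add: \<phi>_def)
  have \<phi>mono: "\<phi> y \<le> \<phi> x" if "y \<le> x" for x y
    using le[OF that] norm_ge_zero[of "P x - P y"] by linarith
  have "(\<phi> \<longlongrightarrow> M / r * 0) at_bot"
    unfolding \<phi>_def by (intro tendsto_intros exp_mult_tendsto_0_at_bot r)
  then have \<phi>lim: "(\<lambda>n. \<phi> (- real n)) \<longlonglongrightarrow> 0"
    by (auto intro: filterlim_compose[OF _ filterlim_compose[OF filterlim_uminus_at_bot_at_top filterlim_real_sequentially]])
  have "Cauchy (\<lambda>n. P (- real n))"
  proof (rule CauchyI)
    fix e :: real assume "0 < e"
    then obtain N where N: "\<phi> (- real N) < e"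
      using order_tendstoD(2)[OF \<phi>lim, of e] by (auto simp: eventually_sequentially)
    have *: "norm (P (- real m) - P (- real n)) < e" if "N \<le> m" "m \<le> n" for m n
      using le[of "- real n" "- real m"] that \<phi>0[of "- real n"] \<phi>mono[of "- real m" "- real N"] N by simp
    then show "\<exists>N. \<forall>m\<ge>N. \<forall>n\<ge>N. norm (P (- real m) - P (- real n)) < e"
      by (metis nat_le_linear norm_minus_commute)
  qed
  then obtain l where l: "(\<lambda>n. P (- real n)) \<longlonglongrightarrow> l"
    using Cauchy_convergent_iff convergent_def by metis
  have Pl: "norm (P x - l) \<le> \<phi> x" for x
  proof (rule tendsto_upperbound)
    show "(\<lambda>n. norm (P x - P (- real n))) \<longlonglongrightarrow> norm (P x - l)" by (intro tendsto_intros l)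
    obtain N where "- x \<le> real N" using real_arch_simple by blast
    then have "norm (P x - P (- real n)) \<le> \<phi> x" if "N \<le> n" for n
      using le[of "- real n" x] \<phi>0[of "- real n"] that by (smt (verit) of_nat_mono)
    then show "eventually (\<lambda>n. norm (P x - P (- real n)) \<le> \<phi> x) sequentially"
      by (auto simp: eventually_sequentially)
  qed simp
  define w where "w x = exp (- \<mu> * of_real x) * (P x - l)" for x
  have "(w has_vector_derivative (h x - \<mu> * w x)) (at x)" for x
  proof -
    have "(w has_vector_derivative exp (- \<mu> * of_real x) * E x + - \<mu> * exp (- \<mu> * of_real x) * (P x - l)) (at x)"
      unfolding w_def
      by (rule has_vector_derivative_mult[OF has_vector_derivative_exp_mult])
         (use has_vector_derivative_diff[OF P has_vector_derivative_const] in simp)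
    moreover have "exp (- \<mu> * of_real x) * E x = h x"
      by (simp add: E_def exp_minus field_simps)
    ultimately show ?thesis by (simp add: w_def mult.assoc)
  qed
  moreover have "norm (w x) \<le> M / r" for x
  proof -
    have "norm (w x) = exp (- (r * x)) * norm (P x - l)"
      by (simp add: w_def norm_mult norm_exp_eq_Re r_def)
    also have "\<dots> \<le> exp (- (r * x)) * \<phi> x" by (intro mult_left_mono Pl) auto
    also have "\<dots> = M / r" by (simp add: \<phi>_def exp_minus field_simps)
    finally show ?thesis .
  qed
  ultimately show ?thesis by blast
qed

text \<open>The reflection \<open>x \<mapsto> - x\<close> exchanges the two signs of \<open>Re \<mu>\<close>.\<close>

lemma has_vector_derivative_reflect:
  assumes "\<And>x::real. (w has_vector_derivative w' x) (at x)"
  shows "((\<lambda>x. - w (- x)) has_vector_derivative w' (- x)) (at x)"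
proof -
  have "((w \<circ> uminus) has_vector_derivative (- 1) *\<^sub>R w' (- x)) (at x)"
    by (rule vector_diff_chain_at[OF _ assms])
      (auto intro!: derivative_eq_intros simp flip: has_real_derivative_iff_has_vector_derivative)
  from has_vector_derivative_minus[OF this] show ?thesis by (simp add: o_def)
qed

lemma bounded_solution_weighted_bound:
  fixes w h :: "real \<Rightarrow> complex"
  assumes \<delta>: "0 < \<delta>" "\<delta> \<le> \<bar>Re \<mu>\<bar>" and A: "1 \<le> A" "2 * real n / \<delta> \<le> A"
    and ode: "\<And>x. (w has_vector_derivative (h x - \<mu> * w x)) (at x)"
    and bdd: "\<And>x. norm (w x) \<le> B"
    and h: "\<And>x. (A\<^sup>2 + x\<^sup>2) ^ n * norm (h x) \<le> M"
  shows "(A\<^sup>2 + x\<^sup>2) ^ n * norm (w x) \<le> 2 * M / \<delta>"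
proof (cases "0 \<le> Re \<mu>")
  case True
  then show ?thesis
    using bounded_solution_weighted_bound_pos[OF \<delta>(1) _ A ode bdd h] \<delta>(2) by simp
next
  case False
  have "(A\<^sup>2 + (- x)\<^sup>2) ^ n * norm (- w (- (- x))) \<le> 2 * M / \<delta>"
  proof (rule bounded_solution_weighted_bound_pos[OF \<delta>(1) _ A])
    show "((\<lambda>x. - w (- x)) has_vector_derivative h (- x) - (- \<mu>) * (- w (- x))) (at x)" for x
      using has_vector_derivative_reflect[OF ode] by simp
    show "(A\<^sup>2 + x\<^sup>2) ^ n * norm (h (- x)) \<le> M" for x using h[of "- x"] by simp
  qed (use False \<delta> bdd in auto)
  then show ?thesis by simp
qed

lemma bounded_solution_exists:
  fixes h :: "real \<Rightarrow> complex"
  assumes "Re \<mu> \<noteq> 0" and cont: "continuous_on UNIV h" and h: "\<And>x. norm (h x) \<le> M"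
  shows "\<exists>w B. (\<forall>x. (w has_vector_derivative (h x - \<mu> * w x)) (at x)) \<and> (\<forall>x. norm (w x) \<le> B)"
proof (cases "0 < Re \<mu>")
  case True
  then show ?thesis using bounded_solution_exists_pos[OF _ cont h] by simp
next
  case False
  have "continuous_on UNIV (\<lambda>x. h (- x))"
    by (intro continuous_on_compose2[OF cont] continuous_intros) auto
  then obtain w B where w: "\<And>x. (w has_vector_derivative (h (- x) - (- \<mu>) * w x)) (at x)"
    and B: "\<And>x. norm (w x) \<le> B"
    using bounded_solution_exists_pos[of "- \<mu>" "\<lambda>x. h (- x)" M] False assms by auto
  have "((\<lambda>x. - w (- x)) has_vector_derivative (h x - \<mu> * (- w (- x)))) (at x)" for x
    using has_vector_derivative_reflect[OF w] by simp
  then show ?thesis using B by (intro exI[of _ "\<lambda>x. - w (- x)"] exI[of _ B]) auto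
qed

text \<open>Solving \<open>c w' + \<mu> w = h\<close> together with all its derivatives: \<open>h b\<close> and \<open>w b\<close> stand for the
  \<open>b\<close>-th derivatives. The bound is uniform in \<open>\<mu>\<close>, which later ranges over all Fourier modes.\<close>

lemma resolvent_ladder:
  fixes c :: complex
  assumes "0 < \<delta>"
  shows "\<exists>C. \<forall>\<mu> h. (if c = 0 then \<delta> \<le> norm \<mu> else \<delta> \<le> \<bar>Re (\<mu> / c)\<bar>) \<longrightarrow>
    (\<forall>b x. (h b has_vector_derivative h (Suc b) x) (at x)) \<longrightarrow>
    (\<forall>b. \<exists>M. \<forall>x. norm (h b x) \<le> M) \<longrightarrow>
    (\<exists>w :: nat \<Rightarrow> real \<Rightarrow> complex.
       (\<forall>b x. (w b has_vector_derivative w (Suc b) x) (at x)) \<and>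
       (\<forall>b x. c * w (Suc b) x + \<mu> * w b x = h b x) \<and>
       (\<forall>n b M. (\<forall>x. (1 + x\<^sup>2) ^ n * norm (h b x) \<le> M) \<longrightarrow>
          (\<forall>x. (1 + x\<^sup>2) ^ n * norm (w b x) \<le> C n * M)))"
proof (cases "c = 0")
  case True
  show ?thesis
  proof (rule exI[of _ "\<lambda>n. 1 / \<delta>"], intro allI impI)
    fix \<mu> :: complex and h :: "nat \<Rightarrow> real \<Rightarrow> complex"
    assume \<mu>: "if c = 0 then \<delta> \<le> norm \<mu> else \<delta> \<le> \<bar>Re (\<mu> / c)\<bar>"
      and h': "\<forall>b x. (h b has_vector_derivative h (Suc b) x) (at x)"
    have l: "\<delta> \<le> norm \<mu>" "\<mu> \<noteq> 0" using \<mu> True assms by auto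
    show "\<exists>w. (\<forall>b x. (w b has_vector_derivative w (Suc b) x) (at x)) \<and>
       (\<forall>b x. c * w (Suc b) x + \<mu> * w b x = h b x) \<and>
       (\<forall>n b M. (\<forall>x. (1 + x\<^sup>2) ^ n * norm (h b x) \<le> M) \<longrightarrow>
          (\<forall>x. (1 + x\<^sup>2) ^ n * norm (w b x) \<le> 1 / \<delta> * M))"
    proof (rule exI[of _ "\<lambda>b x. (1 / \<mu>) * h b x"], intro conjI allI impI)
      show "((\<lambda>x. (1 / \<mu>) * h b x) has_vector_derivative (1 / \<mu>) * h (Suc b) x) (at x)" for b x
        using h' by (intro has_vector_derivative_mult_right) auto
      fix n b x M assume "\<forall>x. (1 + x\<^sup>2) ^ n * norm (h b x) \<le> M"
      then have *: "(1 + x\<^sup>2) ^ n * norm (h b x) \<le> M" by blast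
      have "(1 + x\<^sup>2) ^ n * norm ((1 / \<mu>) * h b x) = 1 / norm \<mu> * ((1 + x\<^sup>2) ^ n * norm (h b x))"
        by (simp add: norm_divide)
      also have "\<dots> \<le> 1 / \<delta> * M"
        using assms l * by (intro mult_mono divide_left_mono) auto
      finally show "(1 + x\<^sup>2) ^ n * norm ((1 / \<mu>) * h b x) \<le> 1 / \<delta> * M" .
    qed (use True l in simp)
  qed
next
  case False
  (* large enough for the weight (A^2 + x^2)^n to vary slowly against exp (delta x) *)
  define A where "A n = max 1 (2 * real n / \<delta>)" for n
  show ?thesis
  proof (rule exI[of _ "\<lambda>n. 2 * (A n) ^ (2 * n) / (\<delta> * norm c)"], intro allI impI)
    fix \<mu> :: complex and h :: "nat \<Rightarrow> real \<Rightarrow> complex"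
    assume "if c = 0 then \<delta> \<le> norm \<mu> else \<delta> \<le> \<bar>Re (\<mu> / c)\<bar>"
      and h': "\<forall>b x. (h b has_vector_derivative h (Suc b) x) (at x)"
      and bdd: "\<forall>b. \<exists>M. \<forall>x. norm (h b x) \<le> M"
    then have l: "\<delta> \<le> \<bar>Re (\<mu> / c)\<bar>" using False by simp
    define \<nu> where "\<nu> = \<mu> / c"
    define g where "g b x = (1 / c) * h b x" for b x
    have g': "(g b has_vector_derivative g (Suc b) x) (at x)" for b x
      unfolding g_def using h' by (intro has_vector_derivative_mult_right) auto
    have gbdd: "\<exists>M. \<forall>x. norm (g b x) \<le> M" for b
    proof -
      obtain M where "\<And>x. norm (h b x) \<le> M" using bdd by blast
      then have "norm (g b x) \<le> M / norm c" for x
        by (simp add: g_def norm_divide divide_right_mono)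
      then show ?thesis by blast
    qed
    have "continuous_on UNIV (g 0)"
      using g' by (intro continuous_at_imp_continuous_on) (auto intro: has_vector_derivative_continuous)
    moreover obtain M0 where "\<And>x. norm (g 0 x) \<le> M0" using gbdd by blast
    moreover have "Re \<nu> \<noteq> 0" using l assms by (auto simp: \<nu>_def)
    ultimately obtain w0 B where w0: "\<And>x. (w0 has_vector_derivative (g 0 x - \<nu> * w0 x)) (at x)"
      and B: "\<And>x. norm (w0 x) \<le> B"
      using bounded_solution_exists[of \<nu> "g 0" M0] by blast
    \<comment> \<open>the equation expresses each derivative of \<open>w0\<close> through the previous one\<close>
    define w where "w = rec_nat w0 (\<lambda>b v x. g b x - \<nu> * v x)"
    have w_0: "w 0 = w0" and w_Suc: "w (Suc b) x = g b x - \<nu> * w b x" for b x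
      by (simp_all add: w_def)
    have w': "(w b has_vector_derivative w (Suc b) x) (at x)" for b x
    proof (induction b arbitrary: x)
      case 0
      then show ?case using w0 by (simp add: w_0 w_Suc)
    next
      case (Suc b)
      have "((\<lambda>x. g b x - \<nu> * w b x) has_vector_derivative g (Suc b) x - \<nu> * w (Suc b) x) (at x)"
        by (intro has_vector_derivative_diff has_vector_derivative_mult_right g' Suc)
      then show ?case unfolding w_Suc[of "Suc b"] by (simp add: w_Suc[abs_def])
    qed
    have wbdd: "\<exists>B. \<forall>x. norm (w b x) \<le> B" for b
    proof (induction b)
      case 0
      then show ?case using B w_0 by auto
    next
      case (Suc b)
      then obtain B where "\<And>x. norm (w b x) \<le> B" by blast
      moreover obtain M where "\<And>x. norm (g b x) \<le> M" using gbdd by blast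
      ultimately have "norm (w (Suc b) x) \<le> M + norm \<nu> * B" for x
        unfolding w_Suc by (intro order_trans[OF norm_triangle_ineq4] add_mono)
          (auto simp: norm_mult intro!: mult_left_mono)
      then show ?case by blast
    qed
    have "(1 + x\<^sup>2) ^ n * norm (w b x) \<le> 2 * (A n) ^ (2 * n) / (\<delta> * norm c) * M"
      if h: "\<forall>x. (1 + x\<^sup>2) ^ n * norm (h b x) \<le> M" for n b M x
    proof -
      have A: "1 \<le> A n" "2 * real n / \<delta> \<le> A n" by (auto simp: A_def)
      have A2: "1 \<le> (A n)\<^sup>2" using A(1) by (simp add: one_le_power)
      obtain B where B: "\<And>x. norm (w b x) \<le> B" using wbdd by blast
      have "((A n)\<^sup>2 + x\<^sup>2) ^ n * norm (g b x) \<le> (A n) ^ (2 * n) * M / norm c" for x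
      proof -
        have "(A n)\<^sup>2 + x\<^sup>2 \<le> (A n)\<^sup>2 * (1 + x\<^sup>2)"
          using mult_right_mono[OF A2, of "x\<^sup>2"] by (simp add: algebra_simps)
        then have "((A n)\<^sup>2 + x\<^sup>2) ^ n \<le> ((A n)\<^sup>2 * (1 + x\<^sup>2)) ^ n"
          by (intro power_mono) auto
        also have "\<dots> = (A n) ^ (2 * n) * (1 + x\<^sup>2) ^ n"
          by (simp add: power_mult_distrib power_mult)
        finally have "((A n)\<^sup>2 + x\<^sup>2) ^ n * norm (h b x) \<le> (A n) ^ (2 * n) * ((1 + x\<^sup>2) ^ n * norm (h b x))"
          by (simp add: mult_right_mono flip: mult.assoc)
        also have "\<dots> \<le> (A n) ^ (2 * n) * M" using h A(1) by (intro mult_left_mono) auto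
        finally show ?thesis by (simp add: g_def norm_divide divide_right_mono)
      qed
      then have "((A n)\<^sup>2 + x\<^sup>2) ^ n * norm (w b x) \<le> 2 * ((A n) ^ (2 * n) * M / norm c) / \<delta>"
        using l w'[of b] unfolding w_Suc
        by (intro bounded_solution_weighted_bound[OF assms _ A _ B]) (auto simp: \<nu>_def)
      moreover have "(1 + x\<^sup>2) ^ n * norm (w b x) \<le> ((A n)\<^sup>2 + x\<^sup>2) ^ n * norm (w b x)"
        using A2 by (intro mult_right_mono power_mono) auto
      ultimately show ?thesis by (simp add: mult_ac)
    qed
    moreover have "c * w (Suc b) x + \<mu> * w b x = h b x" for b x
      using False by (simp add: w_Suc g_def \<nu>_def algebra_simps)
    ultimately show "\<exists>w. (\<forall>b x. (w b has_vector_derivative w (Suc b) x) (at x)) \<and>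
       (\<forall>b x. c * w (Suc b) x + \<mu> * w b x = h b x) \<and>
       (\<forall>n b M. (\<forall>x. (1 + x\<^sup>2) ^ n * norm (h b x) \<le> M) \<longrightarrow>
          (\<forall>x. (1 + x\<^sup>2) ^ n * norm (w b x) \<le> 2 * (A n) ^ (2 * n) / (\<delta> * norm c) * M))"
      using w' by blast
  qed
qed

section \<open>Solving the equation in the Schwartz space\<close>

text \<open>Termwise differentiation: for each derivative and each weight the terms are dominated by a
  multiple of one summable sequence.\<close>

lemma schwartz_jet_series:
  fixes T :: "nat \<Rightarrow> nat \<Rightarrow> nat \<Rightarrow> cyl_fun"
  assumes Tt: "\<And>n a b t x. ((\<lambda>s. T n a b (s, x)) has_vector_derivative T n (Suc a) b (t, x)) (at t)"
    and Tx: "\<And>n a b t x. ((\<lambda>y. T n a b (t, y)) has_vector_derivative T n a (Suc b) (t, x)) (at x)"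
    and per: "\<And>n a b t x. T n a b (t + 2 * pi, x) = T n a b (t, x)"
    and bound: "\<And>a b m. \<exists>M. \<forall>n t x. (1 + x\<^sup>2) ^ m * norm (T n a b (t, x)) \<le> M * \<sigma> n"
    and \<sigma>: "summable \<sigma>"
  shows "schwartz_jet (\<lambda>a b p. \<Sum>n. T n a b p)" and "summable (\<lambda>n. T n a b p)"
proof -
  have ev: "\<exists>M. \<forall>n p. norm (T n a b p) \<le> M * \<sigma> n" for a b
    using bound[of 0 a b] by simp
  have summ: "summable (\<lambda>n. norm (T n a b p))" for a b p
  proof -
    obtain M where "\<And>n p. norm (T n a b p) \<le> M * \<sigma> n" using ev by blast
    then show ?thesis
      by (intro summable_comparison_test'[OF summable_mult[OF \<sigma>, of M]]) auto
  qed
  then show "summable (\<lambda>n. T n a b p)" by (rule summable_norm_cancel)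
  have deriv: "((\<lambda>s. \<Sum>n. f n s) has_vector_derivative (\<Sum>n. f' n t)) (at t)"
    if f: "\<And>n t. (f n has_vector_derivative f' n t) (at t)"
      and M: "\<And>n t. norm (f' n t) \<le> M * \<sigma> n" and s: "\<And>t. summable (\<lambda>n. f n t)"
    for f f' :: "nat \<Rightarrow> real \<Rightarrow> complex" and M t
  proof -
    have unif: "uniform_limit UNIV (\<lambda>n x. \<Sum>i<n. f' i x) (\<lambda>x. \<Sum>n. f' n x) sequentially"
      by (rule Weierstrass_m_test[OF M summable_mult[OF \<sigma>]])
    have "\<exists>g. \<forall>x\<in>UNIV. (\<lambda>n. f n x) sums g x \<and>
        (g has_derivative (\<lambda>h. h *\<^sub>R (\<Sum>n. f' n x))) (at x within UNIV)"
    proof (rule has_derivative_series[where f' = "\<lambda>n x h. h *\<^sub>R f' n x" and x = 0])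
      fix e :: real assume "0 < e"
      from uniform_limitD[OF unif this]
      show "\<forall>\<^sub>F n in sequentially. \<forall>x\<in>UNIV. \<forall>h. norm ((\<Sum>i<n. h *\<^sub>R f' i x) - h *\<^sub>R (\<Sum>n. f' n x)) \<le> e * norm h"
      proof eventually_elim
        case (elim n)
        show ?case
        proof (intro ballI allI)
          fix x h
          have "norm ((\<Sum>i<n. h *\<^sub>R f' i x) - h *\<^sub>R (\<Sum>n. f' n x)) = \<bar>h\<bar> * norm ((\<Sum>i<n. f' i x) - (\<Sum>n. f' n x))"
            by (simp flip: scaleR_sum_right scaleR_diff_right)
          also have "\<dots> \<le> \<bar>h\<bar> * e"
            using elim by (intro mult_left_mono) (auto simp: dist_norm intro: less_imp_le)
          finally show "norm ((\<Sum>i<n. h *\<^sub>R f' i x) - h *\<^sub>R (\<Sum>n. f' n x)) \<le> e * norm h"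
            by (simp add: mult.commute)
        qed
      qed
    qed (use f s in \<open>auto simp: has_vector_derivative_def summable_sums\<close>)
    then obtain g where g: "\<And>x. (\<lambda>n. f n x) sums g x"
        "\<And>x. (g has_vector_derivative (\<Sum>n. f' n x)) (at x)"
      by (auto simp: has_vector_derivative_def)
    have "g = (\<lambda>s. \<Sum>n. f n s)" using g(1) by (auto simp: sums_iff fun_eq_iff)
    then show ?thesis using g(2) by simp
  qed
  show "schwartz_jet (\<lambda>a b p. \<Sum>n. T n a b p)"
    unfolding schwartz_jet_def
  proof (intro conjI allI)
    fix a b t x
    obtain M where "\<And>n p. norm (T n (Suc a) b p) \<le> M * \<sigma> n" using ev by blast
    then show "((\<lambda>s. \<Sum>n. T n a b (s, x)) has_vector_derivative (\<Sum>n. T n (Suc a) b (t, x))) (at t)"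
      by (intro deriv Tt summable_norm_cancel[OF summ])
    obtain M where "\<And>n p. norm (T n a (Suc b) p) \<le> M * \<sigma> n" using ev by blast
    then show "((\<lambda>y. \<Sum>n. T n a b (t, y)) has_vector_derivative (\<Sum>n. T n a (Suc b) (t, x))) (at x)"
      by (intro deriv Tx summable_norm_cancel[OF summ])
    show "(\<Sum>n. T n a b (t + 2 * pi, x)) = (\<Sum>n. T n a b (t, x))" by (simp add: per)
  next
    fix a b m
    obtain M where M: "\<And>n t x. (1 + x\<^sup>2) ^ m * norm (T n a b (t, x)) \<le> M * \<sigma> n"
      using bound by blast
    show "\<exists>M. \<forall>t x. (1 + x\<^sup>2) ^ m * norm (\<Sum>n. T n a b (t, x)) \<le> M"
    proof (intro exI allI)
      fix t x
      have "(1 + x\<^sup>2) ^ m * norm (\<Sum>n. T n a b (t, x)) \<le> (1 + x\<^sup>2) ^ m * (\<Sum>n. norm (T n a b (t, x)))"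
        by (intro mult_left_mono summable_norm summ) auto
      also have "\<dots> = (\<Sum>n. (1 + x\<^sup>2) ^ m * norm (T n a b (t, x)))"
        by (intro suminf_mult[symmetric] summ)
      also have "\<dots> \<le> (\<Sum>n. M * \<sigma> n)"
        by (intro suminf_le M summable_mult summ \<sigma>)
      finally show "(1 + x\<^sup>2) ^ m * norm (\<Sum>n. T n a b (t, x)) \<le> (\<Sum>n. M * \<sigma> n)" .
    qed
  qed
qed

text \<open>Away from finitely many integers the affine function is large.\<close>

lemma affine_bounded_away_from_0:
  fixes p q :: complex
  assumes "\<And>k::int. p * of_int k + q \<noteq> 0"
  shows "\<exists>\<delta>>0. \<forall>k::int. \<delta> \<le> norm (p * of_int k + q)"
proof (cases "p = 0")
  case True
  then show ?thesis using assms[of 0] by (intro exI[of _ "norm q"]) auto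
next
  case False
  define N where "N = \<lceil>(norm q + 1) / norm p\<rceil>"
  have far: "1 \<le> norm (p * of_int k + q)" if "k \<notin> {-N..N}" for k
  proof -
    have "(norm q + 1) / norm p \<le> \<bar>of_int k\<bar>"
      using that le_of_int_ceiling[of "(norm q + 1) / norm p"] by (auto simp: N_def[symmetric])
    then have "norm q + 1 \<le> norm (p * of_int k)" using False by (simp add: norm_mult field_simps)
    then show ?thesis using norm_diff_ineq[of "p * of_int k" q] by simp
  qed
  define \<delta> where "\<delta> = Min (insert 1 ((\<lambda>k. norm (p * of_int k + q)) ` {-N..N}))"
  have "0 < \<delta>" using assms by (simp add: \<delta>_def)
  moreover have "\<delta> \<le> norm (p * of_int k + q)" for k
  proof (cases "k \<in> {-N..N}")
    case True
    then show ?thesis unfolding \<delta>_def by (intro Min_le) auto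
  next
    case False
    have "\<delta> \<le> 1" unfolding \<delta>_def by (intro Min_le) auto
    then show ?thesis using far[OF False] by simp
  qed
  ultimately show ?thesis by blast
qed

text \<open>For \<open>c2 \<noteq> 0\<close> the real variable \<open>\<xi>\<close> can cancel the imaginary part of \<open>(i k c1 + c3) / c2\<close>
  but never the real part, so the hypothesis says that the real part has no zero in \<open>k\<close>.\<close>

lemma symbol_bounded_away:
  fixes c1 c2 c3 :: complex
  assumes nz: "\<And>(k::int) (\<xi>::real). c1 * of_int k + c2 * of_real \<xi> - \<i> * c3 \<noteq> 0"
  shows "\<exists>\<delta>>0. \<forall>k::int. if c2 = 0 then \<delta> \<le> norm (\<i> * of_int k * c1 + c3)
    else \<delta> \<le> \<bar>Re ((\<i> * of_int k * c1 + c3) / c2)\<bar>"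
proof (cases "c2 = 0")
  case True
  have "(\<i> * c1) * of_int k + c3 \<noteq> 0" for k
  proof
    assume *: "(\<i> * c1) * of_int k + c3 = 0"
    have "c1 * of_int k + c2 * of_real 0 - \<i> * c3 = - \<i> * ((\<i> * c1) * of_int k + c3)"
      by (simp add: algebra_simps)
    then show False using nz[of k 0] * by simp
  qed
  from affine_bounded_away_from_0[OF this] show ?thesis using True by (simp add: mult_ac)
next
  case False
  define p where "p = complex_of_real (Re (\<i> * c1 / c2))"
  define q where "q = complex_of_real (Re (c3 / c2))"
  have Re: "complex_of_real (Re ((\<i> * of_int k * c1 + c3) / c2)) = p * of_int k + q" for k
  proof -
    have "(\<i> * of_int k * c1 + c3) / c2 = of_real (of_int k) * (\<i> * c1 / c2) + c3 / c2"
      by (simp add: add_divide_distrib)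
    then have "Re ((\<i> * of_int k * c1 + c3) / c2) = of_int k * Re (\<i> * c1 / c2) + Re (c3 / c2)"
      by (metis Re_complex_of_real plus_complex.simps(1) scaleR_complex.simps(1) scaleR_conv_of_real)
    then show ?thesis by (simp add: p_def q_def)
  qed
  have "p * of_int k + q \<noteq> 0" for k
  proof
    assume "p * of_int k + q = 0"
    then have "Re ((\<i> * of_int k * c1 + c3) / c2) = 0"
      unfolding Re[symmetric] by simp
    then obtain y where "(\<i> * of_int k * c1 + c3) / c2 = \<i> * complex_of_real y"
      by (metis add_0 complex_eq of_real_0)
    then have *: "\<i> * of_int k * c1 + c3 = c2 * (\<i> * of_real y)"
      using False by (simp add: field_simps)
    have "c1 * of_int k + c2 * of_real (- y) - \<i> * c3 = - \<i> * (\<i> * of_int k * c1 + c3 - c2 * (\<i> * of_real y))"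
      by (simp add: algebra_simps)
    then show False using nz[of k "- y"] * by simp
  qed
  from affine_bounded_away_from_0[OF this] obtain \<delta> where \<delta>: "\<delta> > 0" "\<And>k. \<delta> \<le> norm (p * of_int k + q)"
    by blast
  have "\<delta> \<le> \<bar>Re ((\<i> * of_int k * c1 + c3) / c2)\<bar>" for k
    using \<delta>(2)[of k] unfolding Re[symmetric] norm_of_real .
  then show ?thesis using \<delta>(1) False by auto
qed

text \<open>A factor \<open>(i k) ^ a\<close> turns the coefficient of \<open>\<partial>\<^sub>x\<^sup>b f\<close> into that of \<open>\<partial>\<^sub>t\<^sup>a \<partial>\<^sub>x\<^sup>b f\<close>, which the
  Schwartz seminorms bound. This is what gives rapid decay in \<open>k\<close> and \<open>x\<close> together.\<close>

lemma fourier_coeff_ladder: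
  assumes f: "f \<in> schwartz"
  defines "h \<equiv> \<lambda>k b x. fourier_coeff (\<lambda>t. (dx ^^ b) f (t, x)) k"
  shows "(h k b has_vector_derivative h k (Suc b) x) (at x)"
    and "\<exists>M. \<forall>k x. (1 + x\<^sup>2) ^ n * (\<bar>of_int k\<bar> ^ a * norm (h k b x)) \<le> M"
proof -
  have sm: "smooth ((dt ^^ a) ((dx ^^ b) f))" for a b
    by (intro smooth_iterate schwartz_smooth f)
  have contt: "continuous_on A (\<lambda>t. (dt ^^ a) ((dx ^^ b) f) (t, x))" for A a b x
    by (intro continuous_on_compose2[OF smooth_continuous[OF sm]] continuous_intros) auto
  show "(h k b has_vector_derivative h k (Suc b) x) (at x)"
  proof -
    have "((\<lambda>x. integral (cbox 0 (2 * pi)) (\<lambda>t. (dx ^^ b) f (t, x) * cis (- (of_int k * t))))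
        has_vector_derivative
        integral (cbox 0 (2 * pi)) (\<lambda>t. (dx ^^ Suc b) f (t, x) * cis (- (of_int k * t)))) (at x within UNIV)"
    proof (rule leibniz_rule_vector_derivative)
      show "((\<lambda>x. (dx ^^ b) f (t, x) * cis (- (of_int k * t))) has_vector_derivative
          (dx ^^ Suc b) f (t, x) * cis (- (of_int k * t))) (at x within UNIV)" for x t
        using smooth_has_dx[OF sm[of 0 b]] by (intro has_vector_derivative_mult_left) simp
      show "(\<lambda>t. (dx ^^ b) f (t, x) * cis (- (of_int k * t))) integrable_on cbox 0 (2 * pi)" for x
        using contt[of _ 0 b x] by (intro integrable_continuous continuous_intros) simp
      have "continuous_on UNIV (\<lambda>(x, t). (dx ^^ Suc b) f (t, x) * cis (- (of_int k * t)))"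
        unfolding split_def
        by (intro continuous_intros continuous_on_compose2[OF smooth_continuous[OF sm[of 0 "Suc b", unfolded funpow_0 id_apply]]])
          auto
      then show "continuous_on (UNIV \<times> cbox 0 (2 * pi)) (\<lambda>(x, t). (dx ^^ Suc b) f (t, x) * cis (- (of_int k * t)))"
        by (rule continuous_on_subset) auto
    qed auto
    then have "((\<lambda>x. integral {0..2 * pi} (\<lambda>t. (dx ^^ b) f (t, x) * cis (- (of_int k * t))) / of_real (2 * pi))
        has_vector_derivative
        integral {0..2 * pi} (\<lambda>t. (dx ^^ Suc b) f (t, x) * cis (- (of_int k * t))) / of_real (2 * pi)) (at x)"
      unfolding cbox_interval by (rule has_vector_derivative_divide)
    then show ?thesis unfolding h_def fourier_coeff_def .
  qed
  have coeff: "(\<i> * of_int k) ^ a * h k b x = fourier_coeff (\<lambda>t. (dt ^^ a) ((dx ^^ b) f) (t, x)) k" for k a x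
  proof (induction a)
    case 0
    then show ?case by (simp add: h_def)
  next
    case (Suc a)
    have "fourier_coeff (\<lambda>t. (dt ^^ Suc a) ((dx ^^ b) f) (t, x)) k =
        \<i> * of_int k * fourier_coeff (\<lambda>t. (dt ^^ a) ((dx ^^ b) f) (t, x)) k"
      using smooth_has_dt[OF sm[of a b]] contt[of UNIV "Suc a" b x] periodic_iterate[OF schwartz_periodic[OF f], of a b]
      by (intro fourier_coeff_derivative) auto
    then show ?case using Suc by (simp add: mult.assoc)
  qed
  obtain M where M: "\<And>t x. (1 + x\<^sup>2) ^ n * norm ((dt ^^ a) ((dx ^^ b) f) (t, x)) \<le> M"
    using schwartz_weighted_bound[OF f] by blast
  have "(1 + x\<^sup>2) ^ n * (\<bar>of_int k\<bar> ^ a * norm (h k b x)) \<le> M" for k x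
  proof -
    have pos: "0 < (1 + x\<^sup>2) ^ n" by (simp add: add_pos_nonneg)
    have "norm (fourier_coeff (\<lambda>t. (dt ^^ a) ((dx ^^ b) f) (t, x)) k) \<le> M / (1 + x\<^sup>2) ^ n"
      using M[where x = x] pos by (intro norm_fourier_coeff_le contt) (simp add: field_simps)
    then have "\<bar>of_int k\<bar> ^ a * norm (h k b x) \<le> M / (1 + x\<^sup>2) ^ n"
      unfolding coeff[symmetric] by (simp add: norm_mult norm_power)
    then show ?thesis using pos by (simp add: field_simps)
  qed
  then show "\<exists>M. \<forall>k x. (1 + x\<^sup>2) ^ n * (\<bar>of_int k\<bar> ^ a * norm (h k b x)) \<le> M" by blast
qed

text \<open>The solution is the series \<open>\<Sum>\<^sub>k exp (i k t) w\<^sub>k(x)\<close> with \<open>w\<^sub>k\<close> from the resolvent; the operator acts on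
  each term by the ordinary differential equation of its mode, which returns the \<open>k\<close>-th term of the
  Fourier series of \<open>f\<close>.\<close>

lemma schwartz_solvable:
  fixes c1 c2 c3 :: complex
  assumes nz: "\<And>(k::int) (\<xi>::real). c1 * of_int k + c2 * of_real \<xi> - \<i> * c3 \<noteq> 0"
    and f: "f \<in> schwartz"
  shows "\<exists>V. schwartz_jet V \<and> (\<forall>p. c1 * V 1 0 p + c2 * V 0 1 p + c3 * V 0 0 p = f p)"
proof -
  define h where "h k b x = fourier_coeff (\<lambda>t. (dx ^^ b) f (t, x)) k" for k b x
  define \<mu> where "\<mu> k = \<i> * of_int k * c1 + c3" for k :: int
  obtain \<delta> where \<delta>: "0 < \<delta>" "\<And>k. if c2 = 0 then \<delta> \<le> norm (\<mu> k) else \<delta> \<le> \<bar>Re (\<mu> k / c2)\<bar>"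
    using symbol_bounded_away[OF nz] unfolding \<mu>_def by blast
  have h': "(h k b has_vector_derivative h k (Suc b) x) (at x)" for k b x
    using fourier_coeff_ladder(1)[OF f] unfolding h_def .
  have hM: "\<exists>M. \<forall>k x. (1 + x\<^sup>2) ^ n * (\<bar>of_int k\<bar> ^ a * norm (h k b x)) \<le> M" for n a b
    using fourier_coeff_ladder(2)[OF f] unfolding h_def .
  have h_bdd: "\<exists>M. \<forall>x. norm (h k b x) \<le> M" for k b
    using hM[of 0 0 b] by auto
  obtain C where C: "\<And>k. \<exists>w :: nat \<Rightarrow> real \<Rightarrow> complex.
       (\<forall>b x. (w b has_vector_derivative w (Suc b) x) (at x)) \<and>
       (\<forall>b x. c2 * w (Suc b) x + \<mu> k * w b x = h k b x) \<and>
       (\<forall>n b M. (\<forall>x. (1 + x\<^sup>2) ^ n * norm (h k b x) \<le> M) \<longrightarrow>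
          (\<forall>x. (1 + x\<^sup>2) ^ n * norm (w b x) \<le> C n * M))"
    using resolvent_ladder[OF \<delta>(1), of c2] \<delta>(2) h' h_bdd by metis
  define w where "w k = (SOME w. (\<forall>b x. (w b has_vector_derivative w (Suc b) x) (at x)) \<and>
       (\<forall>b x. c2 * w (Suc b) x + \<mu> k * w b x = h k b x) \<and>
       (\<forall>n b M. (\<forall>x. (1 + x\<^sup>2) ^ n * norm (h k b x) \<le> M) \<longrightarrow>
          (\<forall>x. (1 + x\<^sup>2) ^ n * norm (w b x) \<le> C n * M)))" for k
  from someI_ex[OF C] have w': "(w k b has_vector_derivative w k (Suc b) x) (at x)"
    and w_eq: "c2 * w k (Suc b) x + \<mu> k * w k b x = h k b x"
    and w_bound: "(\<And>x. (1 + x\<^sup>2) ^ n * norm (h k b x) \<le> M) \<Longrightarrow> (1 + x\<^sup>2) ^ n * norm (w k b x) \<le> C n * M"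
    for k b x n M unfolding w_def[symmetric] by blast+
  have wM: "\<exists>M. \<forall>k x. (1 + x\<^sup>2) ^ n * (\<bar>of_int k\<bar> ^ a * norm (w k b x)) \<le> M" for n a b
  proof -
    obtain M where M: "\<And>k x. (1 + x\<^sup>2) ^ n * (\<bar>of_int k\<bar> ^ a * norm (h k b x)) \<le> M"
      using hM by blast
    have M0: "0 \<le> M" using order_trans[OF _ M[of 0 0]] by simp
    have "(1 + x\<^sup>2) ^ n * (\<bar>of_int k\<bar> ^ a * norm (w k b x)) \<le> \<bar>C n\<bar> * M" for k x
    proof (cases "\<bar>real_of_int k\<bar> ^ a = 0")
      case True
      then show ?thesis unfolding True using M0 by simp
    next
      case False
      then have pos: "0 < \<bar>real_of_int k\<bar> ^ a"
        using zero_le_power[OF abs_ge_zero, of "real_of_int k" a] by linarith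
      have "(1 + x\<^sup>2) ^ n * norm (h k b x) \<le> M / \<bar>of_int k\<bar> ^ a" for x
        unfolding pos_le_divide_eq[OF pos] using M[of x k] by (simp only: mult_ac)
      from w_bound[OF this] have "(1 + x\<^sup>2) ^ n * norm (w k b x) \<le> C n * (M / \<bar>of_int k\<bar> ^ a)" .
      then have "(1 + x\<^sup>2) ^ n * (\<bar>of_int k\<bar> ^ a * norm (w k b x)) \<le> C n * M"
        unfolding times_divide_eq_right pos_le_divide_eq[OF pos] by (simp only: mult_ac)
      also have "\<dots> \<le> \<bar>C n\<bar> * M" using M0 by (intro mult_right_mono) auto
      finally show ?thesis .
    qed
    then show ?thesis by blast
  qed
  define E where "E k a b = (\<lambda>(t, x). (\<i> * of_int k) ^ a * cis (of_int k * t) * w k b x)" for k a b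
  (* the modes n and - n - 1 are paired, as in the Fourier series above, to sum over naturals *)
  define T where "T n a b p = E (int n) a b p + E (- int n - 1) a b p" for n :: nat and a b p
  have Et: "((\<lambda>s. E k a b (s, x)) has_vector_derivative E k (Suc a) b (t, x)) (at t)" for k a b t x
  proof -
    have "((\<lambda>s. ((\<i> * of_int k) ^ a * w k b x) * cis (of_int k * s)) has_vector_derivative
        ((\<i> * of_int k) ^ a * w k b x) * (\<i> * of_real (of_int k) * cis (of_int k * t))) (at t)"
      by (intro has_vector_derivative_mult_right has_vector_derivative_cis)
    then show ?thesis by (simp add: E_def mult_ac)
  qed
  have Ex: "((\<lambda>y. E k a b (t, y)) has_vector_derivative E k a (Suc b) (t, x)) (at x)" for k a b t x
    unfolding E_def prod.case by (intro has_vector_derivative_mult_right w')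
  have EM: "\<exists>M. \<forall>k t x. (1 + x\<^sup>2) ^ m * norm (E k a b (t, x)) \<le> M / (1 + (of_int k)\<^sup>2)" for a b m
  proof -
    (* two extra powers of k buy the summable factor 1 / (1 + k^2) *)
    obtain M1 where M1: "\<And>k x. (1 + x\<^sup>2) ^ m * (\<bar>of_int k\<bar> ^ a * norm (w k b x)) \<le> M1"
      using wM by blast
    obtain M2 where M2: "\<And>k x. (1 + x\<^sup>2) ^ m * (\<bar>of_int k\<bar> ^ (a + 2) * norm (w k b x)) \<le> M2"
      using wM by blast
    have "(1 + x\<^sup>2) ^ m * norm (E k a b (t, x)) \<le> (M1 + M2) / (1 + (of_int k)\<^sup>2)" for k t x
    proof -
      have pos: "0 < 1 + (real_of_int k)\<^sup>2" by (simp add: add_pos_nonneg)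
      have "(1 + x\<^sup>2) ^ m * norm (E k a b (t, x)) * (1 + (of_int k)\<^sup>2) =
          (1 + x\<^sup>2) ^ m * (\<bar>of_int k\<bar> ^ a * norm (w k b x)) +
          (1 + x\<^sup>2) ^ m * (\<bar>of_int k\<bar> ^ (a + 2) * norm (w k b x))"
        by (simp add: E_def norm_mult norm_power power_add power2_eq_square algebra_simps)
      also have "\<dots> \<le> M1 + M2" by (intro add_mono M1 M2)
      finally show ?thesis by (simp only: pos_le_divide_eq[OF pos])
    qed
    then show ?thesis by blast
  qed
  have Eper: "E k a b (t + 2 * pi, x) = E k a b (t, x)" for k a b t x
    by (simp add: E_def cis_int_periodic)
  have summ: "summable (\<lambda>n. 1 / (1 + (real n)\<^sup>2))"
  proof (rule summable_comparison_test')
    show "summable (\<lambda>n. inverse (real n ^ 2))" by (rule inverse_power_summable) simp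
    show "norm (1 / (1 + (real n)\<^sup>2)) \<le> inverse (real n ^ 2)" if "1 \<le> n" for n
      using that by (simp add: divide_simps not_less)
  qed
  have T_bound: "\<exists>M. \<forall>n t x. (1 + x\<^sup>2) ^ m * norm (T n a b (t, x)) \<le> M * (1 / (1 + (real n)\<^sup>2))" for a b m
  proof -
    obtain M where M: "\<And>k t x. (1 + x\<^sup>2) ^ m * norm (E k a b (t, x)) \<le> M / (1 + (of_int k)\<^sup>2)"
      using EM by blast
    have M0: "0 \<le> M"
      using order_trans[OF norm_ge_zero[of "E 0 a b (0, 0)"], of M] M[of 0 0 0] by simp
    have "(1 + x\<^sup>2) ^ m * norm (T n a b (t, x)) \<le> (2 * M) * (1 / (1 + (real n)\<^sup>2))" for n t x
    proof -
      have "(real n)\<^sup>2 \<le> (real_of_int (- int n - 1))\<^sup>2"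
        by (simp add: power2_eq_square algebra_simps)
      then have neg: "M / (1 + (of_int (- int n - 1))\<^sup>2) \<le> M / (1 + (real n)\<^sup>2)"
        using M0 by (intro divide_left_mono mult_pos_pos) (auto intro!: add_pos_nonneg simp del: of_int_diff)
      have "(1 + x\<^sup>2) ^ m * norm (T n a b (t, x)) \<le>
          (1 + x\<^sup>2) ^ m * (norm (E (int n) a b (t, x)) + norm (E (- int n - 1) a b (t, x)))"
        unfolding T_def by (intro mult_left_mono norm_triangle_ineq) auto
      also have "\<dots> \<le> M / (1 + (of_int (int n))\<^sup>2) + M / (1 + (of_int (- int n - 1))\<^sup>2)"
        unfolding distrib_left by (intro add_mono M)
      also have "\<dots> \<le> M / (1 + (real n)\<^sup>2) + M / (1 + (real n)\<^sup>2)" using neg by simp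
      finally show ?thesis by simp
    qed
    then show ?thesis by blast
  qed
  have Tt: "((\<lambda>s. T n a b (s, x)) has_vector_derivative T n (Suc a) b (t, x)) (at t)"
    and Tx: "((\<lambda>y. T n a b (t, y)) has_vector_derivative T n a (Suc b) (t, x)) (at x)"
    and Tper: "T n a b (t + 2 * pi, x) = T n a b (t, x)" for n a b t x
    unfolding T_def by (intro has_vector_derivative_add Et Ex, intro has_vector_derivative_add Et Ex, simp add: Eper)
  note V = schwartz_jet_series[of T, OF Tt Tx Tper T_bound summ]
  have "c1 * (\<Sum>n. T n 1 0 p) + c2 * (\<Sum>n. T n 0 1 p) + c3 * (\<Sum>n. T n 0 0 p) = f p" for p
  proof -
    obtain t x where p: "p = (t, x)" by (cases p)
    have E_eq: "c1 * E k 1 0 (t, x) + c2 * E k 0 1 (t, x) + c3 * E k 0 0 (t, x) =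
        fourier_coeff (\<lambda>t. f (t, x)) k * cis (of_int k * t)" for k
    proof -
      have "c1 * E k 1 0 (t, x) + c2 * E k 0 1 (t, x) + c3 * E k 0 0 (t, x) =
          (c2 * w k (Suc 0) x + \<mu> k * w k 0 x) * cis (of_int k * t)"
        by (simp add: E_def \<mu>_def algebra_simps)
      then show ?thesis by (simp only: w_eq) (simp add: h_def)
    qed
    have "c1 * (\<Sum>n. T n 1 0 p) + c2 * (\<Sum>n. T n 0 1 p) + c3 * (\<Sum>n. T n 0 0 p) =
        (\<Sum>n. c1 * T n 1 0 p + c2 * T n 0 1 p + c3 * T n 0 0 p)"
      by (simp add: suminf_mult[symmetric] suminf_add V(2) summable_mult summable_add)
    also have "\<dots> = (\<Sum>n. fourier_coeff (\<lambda>t. f (t, x)) (int n) * cis (of_int (int n) * t) +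
        fourier_coeff (\<lambda>t. f (t, x)) (- int n - 1) * cis (of_int (- int n - 1) * t))"
      unfolding E_eq[symmetric] by (simp add: T_def p algebra_simps del: of_int_diff of_int_minus)
    also have "\<dots> = f (t, x)"
      by (intro sums_unique[symmetric] fourier_series_sums[of _ "\<lambda>t. dt f (t, x)"]
          smooth_has_dt schwartz_smooth schwartz_periodic f)
    finally show ?thesis by (simp add: p)
  qed
  then show ?thesis using V(1) by (intro exI[of _ "\<lambda>a b p. \<Sum>n. T n a b p"]) simp
qed

section \<open>Plane waves\<close>

definition plane_wave :: "int \<Rightarrow> real \<Rightarrow> cyl_fun" where
  "plane_wave k \<xi> = (\<lambda>(t, x). cis (of_int k * t) * cis (\<xi> * x))"

lemma norm_plane_wave [simp]: "norm (plane_wave k \<xi> p) = 1"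
  by (cases p) (simp add: plane_wave_def norm_mult)

lemma plane_wave_periodic: "plane_wave k \<xi> (t + 2 * pi, x) = plane_wave k \<xi> (t, x)"
  by (simp add: plane_wave_def cis_int_periodic)

lemma plane_wave_bounded_continuous: "bounded_continuous (\<lambda>p. c * plane_wave k \<xi> p)"
proof -
  have "continuous_on UNIV (\<lambda>p. c * plane_wave k \<xi> p)"
    unfolding plane_wave_def split_def by (intro continuous_intros)
  then show ?thesis by (auto simp: bounded_continuous_def norm_mult intro!: exI[of _ "norm c"])
qed

lemma plane_wave_has_dt:
  "((\<lambda>s. plane_wave k \<xi> (s, x)) has_vector_derivative \<i> * of_int k * plane_wave k \<xi> (t, x)) (at t)"
  using has_vector_derivative_mult_left[OF has_vector_derivative_cis[of "of_int k" t UNIV], of "cis (\<xi> * x)"]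
  by (simp add: plane_wave_def mult.assoc)

lemma plane_wave_has_dx:
  "((\<lambda>y. plane_wave k \<xi> (t, y)) has_vector_derivative \<i> * of_real \<xi> * plane_wave k \<xi> (t, x)) (at x)"
  using has_vector_derivative_mult_right[OF has_vector_derivative_cis[of \<xi> x UNIV], of "cis (of_int k * t)"]
  by (simp add: plane_wave_def mult_ac)

text \<open>Integration by parts moves the derivatives onto the plane wave, where the operator acts as
  multiplication by its symbol.\<close>

lemma first_order_op_plane_wave:
  assumes zero: "c1 * of_int k + c2 * of_real \<xi> - \<i> * c3 = 0" and \<phi>: "\<phi> \<in> schwartz"
  shows "first_order_op c1 c2 c3 (functional_of (plane_wave k \<xi>)) \<phi> = 0"
proof -
  let ?e = "plane_wave k \<xi>"
  define I where "I = strip_integral (\<lambda>p. ?e p * \<phi> p)"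
  have bdd: "bounded_continuous ?e" using plane_wave_bounded_continuous[of 1 k \<xi>] by simp
  have "strip_integral (\<lambda>p. ?e p * dt \<phi> p) = - strip_integral (\<lambda>p. (\<i> * of_int k * ?e p) * \<phi> p)"
    by (rule strip_integration_by_parts_dt[OF plane_wave_has_dt smooth_has_dt[OF schwartz_smooth[OF \<phi>]]
      plane_wave_periodic schwartz_periodic[OF \<phi>] bdd plane_wave_bounded_continuous schwartz_decaying(1,2)[OF \<phi>]])
  then have dt: "strip_integral (\<lambda>p. ?e p * dt \<phi> p) = - (\<i> * of_int k) * I"
    by (simp add: I_def mult.assoc)
  have "strip_integral (\<lambda>p. ?e p * dx \<phi> p) = - strip_integral (\<lambda>p. (\<i> * of_real \<xi> * ?e p) * \<phi> p)"
    by (rule strip_integration_by_parts_dx[OF plane_wave_has_dx smooth_has_dx[OF schwartz_smooth[OF \<phi>]]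
      bdd plane_wave_bounded_continuous schwartz_decaying(1,3)[OF \<phi>]])
  then have dx: "strip_integral (\<lambda>p. ?e p * dx \<phi> p) = - (\<i> * of_real \<xi>) * I"
    by (simp add: I_def mult.assoc)
  have "first_order_op c1 c2 c3 (functional_of ?e) \<phi> =
      c1 * - strip_integral (\<lambda>p. ?e p * dt \<phi> p) + c2 * - strip_integral (\<lambda>p. ?e p * dx \<phi> p) + c3 * I"
    by (simp add: first_order_op_def dist_dt_def dist_dx_def functional_of_def I_def)
  also have "\<dots> = \<i> * (c1 * of_int k + c2 * of_real \<xi> - \<i> * c3) * I"
    unfolding dt dx by (simp add: algebra_simps)
  finally show ?thesis by (simp add: zero)
qed

lemma poly_le_weight:
  fixes p :: "complex poly"
  shows "\<exists>C d. 0 \<le> C \<and> (\<forall>x. norm (poly p (of_real x)) \<le> C * (1 + x\<^sup>2) ^ d)"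
proof (induction p)
  case 0
  show ?case by (intro exI[of _ 0]) simp
next
  case (pCons a p)
  then obtain C d where C: "0 \<le> C" "\<And>x. norm (poly p (of_real x)) \<le> C * (1 + x\<^sup>2) ^ d" by blast
  have "norm (poly (pCons a p) (of_real x)) \<le> (norm a + C) * (1 + x\<^sup>2) ^ Suc d" for x
  proof -
    have "norm (poly (pCons a p) (of_real x)) \<le> norm a + \<bar>x\<bar> * norm (poly p (of_real x))"
      by (simp add: norm_triangle_le norm_mult)
    also have "\<dots> \<le> norm a * (1 + x\<^sup>2) ^ Suc d + (1 + x\<^sup>2) * (C * (1 + x\<^sup>2) ^ d)"
    proof (intro add_mono mult_mono C)
      have "norm a * 1 \<le> norm a * (1 + x\<^sup>2) ^ Suc d"
        by (intro mult_left_mono one_le_power) auto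
      then show "norm a \<le> norm a * (1 + x\<^sup>2) ^ Suc d" by simp
      show "\<bar>x\<bar> \<le> 1 + x\<^sup>2" using abs_power_le_weight[of x 1] by simp
    qed auto
    finally show ?thesis by (simp add: algebra_simps)
  qed
  then show ?case using C(1) by (intro exI[of _ "norm a + C"] exI[of _ "Suc d"]) auto
qed

text \<open>Raising \<open>y \<le> exp y\<close> with \<open>y = \<epsilon> (1 + x\<^sup>2) / m\<close> to the power \<open>m\<close> bounds \<open>(1 + x\<^sup>2) ^ m\<close> by a multiple
  of \<open>exp (\<epsilon> (1 + x\<^sup>2))\<close>; the choice \<open>m = n + 1\<close> keeps \<open>m\<close> positive.\<close>

lemma weight_mult_gaussian_bounded:
  assumes "0 < (\<epsilon>::real)"
  shows "\<exists>C. \<forall>x. (1 + x\<^sup>2) ^ n * exp (- \<epsilon> * x\<^sup>2) \<le> C"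
proof -
  define m where "m = real (Suc n)"
  have m: "0 < m" by (simp add: m_def)
  have "(1 + x\<^sup>2) ^ n * exp (- \<epsilon> * x\<^sup>2) \<le> (m / \<epsilon>) ^ Suc n * exp \<epsilon>" for x
  proof -
    have "\<epsilon> * (1 + x\<^sup>2) / m \<le> exp (\<epsilon> * (1 + x\<^sup>2) / m)"
      using exp_ge_add_one_self[of "\<epsilon> * (1 + x\<^sup>2) / m"] by linarith
    then have base: "1 + x\<^sup>2 \<le> m / \<epsilon> * exp (\<epsilon> * (1 + x\<^sup>2) / m)"
      using assms m by (simp add: field_simps)
    have exponent: "of_nat (Suc n) * (\<epsilon> * (1 + x\<^sup>2) / m) = \<epsilon> * (1 + x\<^sup>2)"
      unfolding m_def[symmetric] using m by simp
    from base have "(1 + x\<^sup>2) ^ Suc n \<le> (m / \<epsilon> * exp (\<epsilon> * (1 + x\<^sup>2) / m)) ^ Suc n"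
      by (intro power_mono) auto
    also have "\<dots> = (m / \<epsilon>) ^ Suc n * exp (\<epsilon> * (1 + x\<^sup>2))"
      by (simp only: power_mult_distrib exp_of_nat_mult[symmetric] exponent)
    finally have le: "(1 + x\<^sup>2) ^ Suc n \<le> (m / \<epsilon>) ^ Suc n * exp (\<epsilon> * (1 + x\<^sup>2))" .
    have "(1 + x\<^sup>2) ^ n \<le> (1 + x\<^sup>2) ^ Suc n" by (intro power_increasing) auto
    then have "(1 + x\<^sup>2) ^ n * exp (- \<epsilon> * x\<^sup>2) \<le> (m / \<epsilon>) ^ Suc n * exp (\<epsilon> * (1 + x\<^sup>2)) * exp (- \<epsilon> * x\<^sup>2)"
      using le by (intro mult_right_mono) auto
    also have "\<dots> = (m / \<epsilon>) ^ Suc n * exp \<epsilon>"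
      unfolding mult.assoc exp_add[symmetric] by (simp add: distrib_left)
    finally show ?thesis .
  qed
  then show ?thesis by blast
qed

text \<open>The conjugate plane wave under a Gaussian envelope, so that the product with the plane wave
  is the envelope.\<close>

definition gaussian_packet :: "real \<Rightarrow> int \<Rightarrow> real \<Rightarrow> cyl_fun" where
  "gaussian_packet \<epsilon> k \<xi> = (\<lambda>(t, x). cis (- (of_int k * t)) * exp (- \<i> * \<xi> * x - \<epsilon> * (of_real x)\<^sup>2))"

lemma norm_gaussian_packet: "norm (gaussian_packet \<epsilon> k \<xi> (t, x)) = exp (- \<epsilon> * x\<^sup>2)"
  by (simp add: gaussian_packet_def norm_mult norm_exp_eq_Re flip: of_real_power)

lemma plane_wave_mult_gaussian_packet:
  "plane_wave k \<xi> (t, x) * gaussian_packet \<epsilon> k \<xi> (t, x) = of_real (exp (- \<epsilon> * x\<^sup>2))"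
proof -
  have "plane_wave k \<xi> (t, x) * gaussian_packet \<epsilon> k \<xi> (t, x) =
      (cis (of_int k * t) * cis (- (of_int k * t))) *
      (exp (\<i> * (\<xi> * x)) * exp (- \<i> * \<xi> * x - \<epsilon> * (of_real x)\<^sup>2))"
    by (simp add: plane_wave_def gaussian_packet_def cis_conv_exp mult_ac)
  also have "\<dots> = exp (of_real (- \<epsilon> * x\<^sup>2))"
    unfolding cis_mult exp_add[symmetric] by simp
  finally show ?thesis by (simp only: exp_of_real)
qed

lemma gaussian_packet_schwartz:
  assumes "0 < \<epsilon>"
  shows "gaussian_packet \<epsilon> k \<xi> \<in> schwartz"
proof -
  define G where "G z = exp (- \<i> * \<xi> * z - \<epsilon> * z\<^sup>2)" for z :: complex
  (* the b-th x-derivative of the packet is its x-dependent factor G times the polynomial P b *)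
  define P where "P = rec_nat (1 :: complex poly) (\<lambda>b p. pderiv p + [:- \<i> * \<xi>, - 2 * \<epsilon>:] * p)"
  have P_0: "P 0 = 1" and P_Suc: "P (Suc b) = pderiv (P b) + [:- \<i> * \<xi>, - 2 * \<epsilon>:] * P b" for b
    by (simp_all add: P_def)
  have field: "((\<lambda>z. poly (P b) z * G z) has_field_derivative poly (P (Suc b)) z * G z) (at z)" for b z
  proof -
    have "(G has_field_derivative G z * (- \<i> * \<xi> - 2 * \<epsilon> * z)) (at z)"
      unfolding G_def by (auto intro!: derivative_eq_intros)
    from DERIV_mult[OF poly_DERIV[of "P b"] this]
    show ?thesis by (simp add: P_Suc algebra_simps)
  qed
  define F where "F a b = (\<lambda>(t, x). ((- \<i> * of_int k) ^ a * cis (- (of_int k * t))) * (poly (P b) (of_real x) * G (of_real x)))"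
    for a b
  have "schwartz_jet F"
    unfolding schwartz_jet_def
  proof (intro conjI allI)
    fix a b t x
    have "((\<lambda>s. cis (- of_int k * s)) has_vector_derivative \<i> * of_real (- of_int k) * cis (- of_int k * t)) (at t)"
      by (rule has_vector_derivative_cis)
    from has_vector_derivative_mult_right[OF this, of "(- \<i> * of_int k) ^ a * (poly (P b) (of_real x) * G (of_real x))"]
    show "((\<lambda>s. F a b (s, x)) has_vector_derivative F (Suc a) b (t, x)) (at t)"
      by (simp add: F_def mult_ac)
    show "((\<lambda>y. F a b (t, y)) has_vector_derivative F a (Suc b) (t, x)) (at x)"
      unfolding F_def prod.case
      by (intro has_vector_derivative_mult_right has_vector_derivative_real_field field)
    show "F a b (t + 2 * pi, x) = F a b (t, x)"
      using cis_int_periodic[of "- k" t] by (simp add: F_def)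
  next
    fix a b n
    obtain C d where C: "0 \<le> C" "\<And>x. norm (poly (P b) (of_real x)) \<le> C * (1 + x\<^sup>2) ^ d"
      using poly_le_weight by blast
    obtain B where B: "\<And>x. (1 + x\<^sup>2) ^ (n + d) * exp (- \<epsilon> * x\<^sup>2) \<le> B"
      using weight_mult_gaussian_bounded[OF assms] by blast
    show "\<exists>M. \<forall>t x. (1 + x\<^sup>2) ^ n * norm (F a b (t, x)) \<le> M"
    proof (intro exI allI)
      fix t x
      have G: "norm (G (of_real x)) = exp (- \<epsilon> * x\<^sup>2)"
        by (simp add: G_def norm_exp_eq_Re flip: of_real_power)
      have "(1 + x\<^sup>2) ^ n * norm (F a b (t, x)) =
          \<bar>of_int k\<bar> ^ a * ((1 + x\<^sup>2) ^ n * exp (- \<epsilon> * x\<^sup>2) * norm (poly (P b) (of_real x)))"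
        by (simp add: F_def norm_mult norm_power G)
      also have "\<dots> \<le> \<bar>of_int k\<bar> ^ a * ((1 + x\<^sup>2) ^ n * exp (- \<epsilon> * x\<^sup>2) * (C * (1 + x\<^sup>2) ^ d))"
        by (intro mult_left_mono C) auto
      also have "\<dots> = \<bar>of_int k\<bar> ^ a * (C * ((1 + x\<^sup>2) ^ (n + d) * exp (- \<epsilon> * x\<^sup>2)))"
        by (simp add: power_add)
      also have "\<dots> \<le> \<bar>of_int k\<bar> ^ a * (C * B)"
        by (intro mult_left_mono B C) auto
      finally show "(1 + x\<^sup>2) ^ n * norm (F a b (t, x)) \<le> \<bar>of_int k\<bar> ^ a * (C * B)" .
    qed
  qed
  from schwartz_jet_in_schwartz[OF this, of 0 0] show ?thesis
    by (simp add: F_def P_0 G_def gaussian_packet_def)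
qed

text \<open>With \<open>\<epsilon> = 1 / R\<^sup>2\<close> the packet has modulus at most one, and its envelope is at least \<open>exp (-1)\<close> for
  \<open>\<bar>x\<bar> \<le> R\<close>. Hence pairing it with the plane wave gives at least \<open>4 \<pi> R exp (-1)\<close>, whereas pairing it with
  \<open>f\<close> gives at most the integral of \<open>\<bar>f\<bar>\<close>.\<close>

lemma plane_wave_not_schwartz: "\<not> is_schwartz (functional_of (plane_wave k \<xi>))"
proof
  assume "is_schwartz (functional_of (plane_wave k \<xi>))"
  then obtain f where f: "f \<in> schwartz"
    and eq: "\<And>\<phi>. \<phi> \<in> schwartz \<Longrightarrow> functional_of (plane_wave k \<xi>) \<phi> = functional_of f \<phi>"
    unfolding is_schwartz_def by blast
  define K where "K = (LINT p:strip|lborel. norm (f p))"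
  have lower: "4 * pi * R * exp (- 1) \<le> K" if R: "0 < R" for R
  proof -
    define \<epsilon> where "\<epsilon> = 1 / R\<^sup>2"
    define \<phi> where "\<phi> = gaussian_packet \<epsilon> k \<xi>"
    have \<epsilon>: "0 < \<epsilon>" using R by (simp add: \<epsilon>_def)
    have \<phi>: "\<phi> \<in> schwartz" unfolding \<phi>_def by (rule gaussian_packet_schwartz[OF \<epsilon>])
    have \<phi>1: "norm (\<phi> p) \<le> 1" for p
      using \<epsilon> by (cases p) (simp add: \<phi>_def norm_gaussian_packet)
    have "bounded_continuous f" by (rule decaying_imp_bounded[OF schwartz_decaying(1)[OF f]])
    then have int: "set_integrable lborel strip (\<lambda>p. f p * \<phi> p)"
      by (intro decaying_integrable decaying_mult schwartz_decaying \<phi>)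
    have "norm (functional_of f \<phi>) \<le> (LINT p:strip|lborel. norm (f p * \<phi> p))"
      unfolding functional_of_def by (rule set_integral_norm_bound[OF int])
    also have "\<dots> \<le> K"
      unfolding K_def
      by (intro set_integral_mono set_integrable_norm int decaying_integrable schwartz_decaying f)
        (use mult_left_mono[OF \<phi>1] in \<open>simp add: norm_mult\<close>)
    finally have upper: "norm (functional_of f \<phi>) \<le> K" .
    have gauss: "plane_wave k \<xi> p * \<phi> p = of_real (exp (- \<epsilon> * (snd p)\<^sup>2))" for p
      by (cases p) (simp add: \<phi>_def plane_wave_mult_gaussian_packet)
    have val: "functional_of (plane_wave k \<xi>) \<phi> = of_real (LINT p:strip|lborel. exp (- \<epsilon> * (snd p)\<^sup>2))"
      unfolding functional_of_def gauss set_integral_complex_of_real ..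
    have "bounded_continuous (plane_wave k \<xi>)" using plane_wave_bounded_continuous[of 1 k \<xi>] by simp
    then have "set_integrable lborel strip (\<lambda>p. norm (plane_wave k \<xi> p * \<phi> p))"
      by (intro set_integrable_norm decaying_integrable decaying_mult schwartz_decaying \<phi>)
    then have intg: "set_integrable lborel strip (\<lambda>p. exp (- \<epsilon> * (snd p)\<^sup>2))"
      unfolding gauss by simp
    let ?Q = "{0..<2 * pi} \<times> {-R..R}"
    have em: "emeasure lborel ?Q = ennreal (2 * pi * (2 * R))"
      using R unfolding lborel_prod[symmetric]
      by (subst lborel.emeasure_pair_measure_Times) (auto simp flip: ennreal_mult)
    have Q: "?Q \<in> sets lborel" by (simp add: borel_Times)
    have "4 * pi * R * exp (- 1) = (LINT p|lborel. indicator ?Q p *\<^sub>R exp (- 1))"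
      using R em Q by (simp add: measure_def)
    also have "\<dots> \<le> (LINT p|lborel. indicator strip p *\<^sub>R exp (- \<epsilon> * (snd p)\<^sup>2))"
    proof (rule integral_mono)
      show "integrable lborel (\<lambda>p. indicator ?Q p *\<^sub>R exp (- 1 :: real))"
        using em Q by (intro integrable_scaleR_left integrable_real_indicator) auto
      show "integrable lborel (\<lambda>p. indicator strip p *\<^sub>R exp (- \<epsilon> * (snd p)\<^sup>2))"
        using intg by (simp add: set_integrable_def)
      show "indicator ?Q p *\<^sub>R exp (- 1) \<le> indicator strip p *\<^sub>R exp (- \<epsilon> * (snd p)\<^sup>2)" for p
      proof (cases "p \<in> ?Q")
        case True
        then have "\<bar>snd p\<bar> \<le> \<bar>R\<bar>" by (auto simp: abs_le_iff)
        then have "(snd p)\<^sup>2 \<le> R\<^sup>2" by (simp only: abs_le_square_iff)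
        then have "\<epsilon> * (snd p)\<^sup>2 \<le> 1" using R by (simp add: \<epsilon>_def field_simps)
        then show ?thesis using True by (auto simp: indicator_def)
      qed simp
    qed
    also have "\<dots> = norm (functional_of (plane_wave k \<xi>) \<phi>)"
      unfolding val norm_of_real set_lebesgue_integral_def
      by (subst abs_of_nonneg) (auto intro!: Bochner_Integration.integral_nonneg)
    also have "\<dots> \<le> K" using upper eq[OF \<phi>] by simp
    finally show ?thesis .
  qed
  define R where "R = (\<bar>K\<bar> + 1) / (4 * pi * exp (- 1))"
  have "0 < R" by (simp add: R_def)
  moreover have "4 * pi * R * exp (- 1) = \<bar>K\<bar> + 1" by (simp add: R_def)
  ultimately show False using lower[of R] by simp
qed

section \<open>The characterisation\<close>

lemma zero_is_schwartz:
  assumes "\<And>\<phi>. \<phi> \<in> schwartz \<Longrightarrow> u \<phi> = 0"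
  shows "is_schwartz u"
proof -
  have "schwartz_jet (\<lambda>a b p. 0)" by (auto simp: schwartz_jet_def)
  from schwartz_jet_in_schwartz[OF this] have "(\<lambda>p. 0) \<in> schwartz" .
  then show ?thesis
    using assms by (auto simp: is_schwartz_def functional_of_def set_lebesgue_integral_def
        intro!: bexI[of _ "\<lambda>p. 0"])
qed

lemma strip_integral_first_order_transpose:
  assumes V: "schwartz_jet V" and \<Psi>: "schwartz_jet \<Psi>"
  shows "strip_integral (\<lambda>p. (c1 * V 1 0 p + c2 * V 0 1 p + c3 * V 0 0 p) * \<Psi> 0 0 p) =
    strip_integral (\<lambda>p. V 0 0 p * (- c1 * \<Psi> 1 0 p + - c2 * \<Psi> 0 1 p + c3 * \<Psi> 0 0 p))"
proof -
  have dec: "decaying (\<Psi> a b)" "decaying (V a b)" for a b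
    by (intro schwartz_decaying schwartz_jet_in_schwartz V \<Psi>)+
  note bdd = decaying_imp_bounded[OF dec(2)]
  have dt: "strip_integral (\<lambda>p. V 0 0 p * \<Psi> 1 0 p) = - strip_integral (\<lambda>p. V 1 0 p * \<Psi> 0 0 p)"
    unfolding One_nat_def
    by (rule strip_integration_by_parts_dt[OF schwartz_jetD(1)[OF V] schwartz_jetD(1)[OF \<Psi>]
      schwartz_jetD(3)[OF V] schwartz_jetD(3)[OF \<Psi>] bdd bdd dec(1) dec(1)])
  have dx: "strip_integral (\<lambda>p. V 0 0 p * \<Psi> 0 1 p) = - strip_integral (\<lambda>p. V 0 1 p * \<Psi> 0 0 p)"
    unfolding One_nat_def
    by (rule strip_integration_by_parts_dx[OF schwartz_jetD(2)[OF V] schwartz_jetD(2)[OF \<Psi>]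
      bdd bdd dec(1) dec(1)])
  have decm: "decaying (\<lambda>p. c * (V a b p * \<Psi> i j p))" for c a b i j
    by (rule decaying_mult) (auto intro!: decaying_mult bdd dec simp: bounded_continuous_def)
  have "strip_integral (\<lambda>p. (c1 * V 1 0 p + c2 * V 0 1 p + c3 * V 0 0 p) * \<Psi> 0 0 p) =
      strip_integral (\<lambda>p. c1 * (V 1 0 p * \<Psi> 0 0 p) + c2 * (V 0 1 p * \<Psi> 0 0 p) + c3 * (V 0 0 p * \<Psi> 0 0 p))"
    by (simp add: algebra_simps)
  also have "\<dots> = c1 * strip_integral (\<lambda>p. V 1 0 p * \<Psi> 0 0 p) + c2 * strip_integral (\<lambda>p. V 0 1 p * \<Psi> 0 0 p)
      + c3 * strip_integral (\<lambda>p. V 0 0 p * \<Psi> 0 0 p)"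
    by (simp add: strip_integral_add decaying_add decm)
  also have "\<dots> = (- c1) * strip_integral (\<lambda>p. V 0 0 p * \<Psi> 1 0 p) + (- c2) * strip_integral (\<lambda>p. V 0 0 p * \<Psi> 0 1 p)
      + c3 * strip_integral (\<lambda>p. V 0 0 p * \<Psi> 0 0 p)"
    by (simp add: dt dx del: One_nat_def)
  also have "\<dots> = strip_integral (\<lambda>p. (- c1) * (V 0 0 p * \<Psi> 1 0 p) + (- c2) * (V 0 0 p * \<Psi> 0 1 p) + c3 * (V 0 0 p * \<Psi> 0 0 p))"
    by (simp only: strip_integral_add decaying_add decm set_integral_mult_right)
  also have "\<dots> = strip_integral (\<lambda>p. V 0 0 p * (- c1 * \<Psi> 1 0 p + - c2 * \<Psi> 0 1 p + c3 * \<Psi> 0 0 p))"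
    by (simp add: algebra_simps)
  finally show ?thesis .
qed


lemma schwartz_jet_scale:
  assumes F: "schwartz_jet F"
  shows "schwartz_jet (\<lambda>a b p. c * F a b p)"
proof -
  have "\<exists>M. \<forall>t x. (1 + x\<^sup>2) ^ n * norm (c * F a b (t, x)) \<le> M" for a b n
  proof -
    obtain M where "\<And>t x. (1 + x\<^sup>2) ^ n * norm (F a b (t, x)) \<le> M"
      using schwartz_jetD(4)[OF F] by blast
    then have "norm c * ((1 + x\<^sup>2) ^ n * norm (F a b (t, x))) \<le> norm c * M" for t x
      by (intro mult_left_mono) auto
    then show ?thesis by (auto simp: norm_mult mult_ac intro!: exI[of _ "norm c * M"])
  qed
  then show ?thesis
    using schwartz_jetD(1-3)[OF F] by (auto simp: schwartz_jet_def intro!: has_vector_derivative_mult_right)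
qed

lemma schwartz_jet_add:
  assumes F: "schwartz_jet F" and G: "schwartz_jet G"
  shows "schwartz_jet (\<lambda>a b p. F a b p + G a b p)"
proof -
  have "\<exists>M. \<forall>t x. (1 + x\<^sup>2) ^ n * norm (F a b (t, x) + G a b (t, x)) \<le> M" for a b n
  proof -
    obtain M where M: "\<And>t x. (1 + x\<^sup>2) ^ n * norm (F a b (t, x)) \<le> M"
      using schwartz_jetD(4)[OF F] by blast
    obtain N where N: "\<And>t x. (1 + x\<^sup>2) ^ n * norm (G a b (t, x)) \<le> N"
      using schwartz_jetD(4)[OF G] by blast
    have "(1 + x\<^sup>2) ^ n * norm (F a b (t, x) + G a b (t, x)) \<le> M + N" for t x
      by (intro order_trans[OF mult_left_mono[OF norm_triangle_ineq]])
        (auto simp: distrib_left intro!: add_mono M N)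
    then show ?thesis by blast
  qed
  then show ?thesis
    using schwartz_jetD(1-3)[OF F] schwartz_jetD(1-3)[OF G]
    by (auto simp: schwartz_jet_def intro!: has_vector_derivative_add)
qed

lemma schwartz_jet_shift: "schwartz_jet F \<Longrightarrow> schwartz_jet (\<lambda>a b. F (a + i) (b + j))"
  by (simp add: schwartz_jet_def)

lemma tempered_first_order_transpose:
  assumes u: "u \<in> tempered" and \<Psi>: "schwartz_jet \<Psi>"
  shows "u (\<lambda>p. - c1 * \<Psi> 1 0 p + - c2 * \<Psi> 0 1 p + c3 * \<Psi> 0 0 p) = first_order_op c1 c2 c3 u (\<Psi> 0 0)"
proof -
  have sh: "schwartz_jet (\<lambda>a b p. c * \<Psi> (a + i) (b + j) p)" for c i j
    by (intro schwartz_jet_scale schwartz_jet_shift \<Psi>)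
  have 1: "(\<lambda>p. c * \<Psi> i j p) \<in> schwartz" for c i j
    using schwartz_jet_in_schwartz[OF sh[of c i j], of 0 0] by simp
  have 2: "(\<lambda>p. c * \<Psi> i j p + d * \<Psi> k l p) \<in> schwartz" for c d i j k l
    using schwartz_jet_in_schwartz[OF schwartz_jet_add[OF sh[of c i j] sh[of d k l]], of 0 0] by simp
  have add: "u (\<lambda>p. f p + g p) = u f + u g" if "f \<in> schwartz" "g \<in> schwartz" for f g
    using u that by (auto simp: tempered_def)
  have mult: "u (\<lambda>p. a * f p) = a * u f" if "f \<in> schwartz" for a f
    using u that by (auto simp: tempered_def)
  have "u (\<lambda>p. - c1 * \<Psi> 1 0 p + - c2 * \<Psi> 0 1 p + c3 * \<Psi> 0 0 p) =
      - c1 * u (\<Psi> 1 0) + - c2 * u (\<Psi> 0 1) + c3 * u (\<Psi> 0 0)"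
    by (simp only: add[OF 2 1] add[OF 1 1] mult[OF schwartz_jet_in_schwartz[OF \<Psi>]])
  then show ?thesis
    by (simp add: first_order_op_def dist_dt_def dist_dx_def schwartz_jet_dt[OF \<Psi>] schwartz_jet_dx[OF \<Psi>])
qed

text \<open>Both \<open>L\<close> and its transpose are onto; testing \<open>u\<close> on \<open>\<phi>\<close> written as the transpose of \<open>\<Psi>\<close> identifies
  it with the Schwartz solution of \<open>L v = f\<close>.\<close>

lemma hypoelliptic_of_symbol_nonzero:
  fixes c1 c2 c3 :: complex
  assumes nz: "\<And>(k::int) (\<xi>::real). c1 * of_int k + c2 * of_real \<xi> - \<i> * c3 \<noteq> 0"
  shows "schwartz_globally_hypoelliptic (first_order_op c1 c2 c3)"
  unfolding schwartz_globally_hypoelliptic_def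
proof (intro ballI impI)
  fix u assume u: "u \<in> tempered" and "is_schwartz (first_order_op c1 c2 c3 u)"
  then obtain f where f: "f \<in> schwartz"
    and Lu: "\<And>\<phi>. \<phi> \<in> schwartz \<Longrightarrow> first_order_op c1 c2 c3 u \<phi> = functional_of f \<phi>"
    unfolding is_schwartz_def by blast
  obtain V where V: "schwartz_jet V" "\<And>p. c1 * V 1 0 p + c2 * V 0 1 p + c3 * V 0 0 p = f p"
    using schwartz_solvable[OF nz f] by blast
  have nz': "- c1 * of_int k + - c2 * of_real \<xi> - \<i> * c3 \<noteq> 0" for k :: int and \<xi> :: real
    using nz[of "- k" "- \<xi>"] by simp
  have "u \<phi> = functional_of (V 0 0) \<phi>" if \<phi>: "\<phi> \<in> schwartz" for \<phi>
  proof -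
    obtain \<Psi> where \<Psi>: "schwartz_jet \<Psi>" "\<And>p. - c1 * \<Psi> 1 0 p + - c2 * \<Psi> 0 1 p + c3 * \<Psi> 0 0 p = \<phi> p"
      using schwartz_solvable[OF nz' \<phi>] by blast
    have "u \<phi> = first_order_op c1 c2 c3 u (\<Psi> 0 0)"
      using tempered_first_order_transpose[OF u \<Psi>(1), of c1 c2 c3] unfolding \<Psi>(2) .
    also have "\<dots> = strip_integral (\<lambda>p. f p * \<Psi> 0 0 p)"
      using Lu[OF schwartz_jet_in_schwartz[OF \<Psi>(1)]] by (simp add: functional_of_def)
    also have "\<dots> = strip_integral (\<lambda>p. V 0 0 p * \<phi> p)"
      using strip_integral_first_order_transpose[OF V(1) \<Psi>(1), of c1 c2 c3] unfolding V(2) \<Psi>(2) .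
    finally show ?thesis by (simp add: functional_of_def)
  qed
  then show "is_schwartz u"
    using schwartz_jet_in_schwartz[OF V(1)] unfolding is_schwartz_def by blast
qed

theorem corollary3p1:
  fixes c1 c2 c3 :: complex
  assumes "c1 \<noteq> 0 \<or> c2 \<noteq> 0"
  shows "schwartz_globally_hypoelliptic (first_order_op c1 c2 c3) \<longleftrightarrow>
    {(k :: int, \<xi> :: real). c1 * of_int k + c2 * of_real \<xi> - \<i> * c3 = 0} = {}"
proof
  assume sgh: "schwartz_globally_hypoelliptic (first_order_op c1 c2 c3)"
  show "{(k :: int, \<xi> :: real). c1 * of_int k + c2 * of_real \<xi> - \<i> * c3 = 0} = {}"
  proof (rule ccontr)
    assume "\<not> ?thesis"
    then obtain k \<xi> where zero: "c1 * of_int k + c2 * of_real \<xi> - \<i> * c3 = 0" by auto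
    have "functional_of (plane_wave k \<xi>) \<in> tempered"
      using bounded_functional_tempered[OF plane_wave_bounded_continuous[of 1 k \<xi>]] by simp
    moreover have "is_schwartz (first_order_op c1 c2 c3 (functional_of (plane_wave k \<xi>)))"
      by (intro zero_is_schwartz first_order_op_plane_wave[OF zero])
    ultimately show False
      using sgh plane_wave_not_schwartz unfolding schwartz_globally_hypoelliptic_def by blast
  qed
next
  assume "{(k :: int, \<xi> :: real). c1 * of_int k + c2 * of_real \<xi> - \<i> * c3 = 0} = {}"
  then show "schwartz_globally_hypoelliptic (first_order_op c1 c2 c3)"
    by (intro hypoelliptic_of_symbol_nonzero) blast
qed

end
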